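(* For every integer $m\le0$ the set $I_m$ contains a nondegenerate interval, and for every integer $m\ge1$ the set $S_m$ contains a nondegenerate interval, where $$I_m=\left\{\liminf_{k\to\infty}q_{k+m}\|q_k\alpha\| : \alpha\in[0,1]\setminus\mathbb{Q}\right\}\ (m\le0),\qquad S_m=\left\{\limsup_{k\to\infty}q_{k+m}\|q_k\alpha\| : \alpha\in[0,1]\setminus\mathbb{Q}\right\}\ (m\ge1).$$
   Context: For irrational $\alpha\in[0,1]$, $q_k=q_k(\alpha)$ denotes the denominator of the $k$-th best approximant (of the second kind), i.e. of the $k$-th continued fraction convergent $p_k/q_k$ of $\alpha$. $\|x\|$ denotes the distance from $x$ to $\mathbb{Z}$. *)

theory Defs
  imports "HOL-Analysis.Analysis"
begin

definition dist_Z :: "real \<Rightarrow> real" where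
  "dist_Z x = infdist x \<int>"

text \<open>Complete quotients and partial quotients of the continued fraction
  \<open>\<alpha> = [a\<^sub>0; a\<^sub>1, a\<^sub>2, \<dots>]\<close>.  The values are the intended ones for irrational \<open>\<alpha>\<close>, where
  no division by zero occurs.\<close>

fun cf_tail :: "real \<Rightarrow> nat \<Rightarrow> real" where
  "cf_tail \<alpha> 0 = \<alpha>"
| "cf_tail \<alpha> (Suc k) = 1 / frac (cf_tail \<alpha> k)"

definition cf_coeff :: "real \<Rightarrow> nat \<Rightarrow> int" where
  "cf_coeff \<alpha> k = \<lfloor>cf_tail \<alpha> k\<rfloor>"

fun cf_eval :: "rat list \<Rightarrow> rat" where
  "cf_eval [] = 0"
| "cf_eval [a] = a"
| "cf_eval (a # b # as) = a + 1 / cf_eval (b # as)"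

definition cf_convergent :: "real \<Rightarrow> nat \<Rightarrow> rat" where
  "cf_convergent \<alpha> k = cf_eval (map (\<lambda>i. of_int (cf_coeff \<alpha> i)) [0..<Suc k])"

text \<open>\<open>quotient_of\<close> returns numerator and denominator in lowest terms, with positive denominator.
  Numbering starts with \<open>q\<^sub>0 = 1\<close> and \<open>q\<^sub>1 = a\<^sub>1\<close>.\<close>

definition cf_denom :: "real \<Rightarrow> nat \<Rightarrow> int" where
  "cf_denom \<alpha> k = snd (quotient_of (cf_convergent \<alpha> k))"

text \<open>The index \<open>k + m\<close> is negative only for finitely many \<open>k\<close>, so its truncation by \<open>nat\<close>
  affects neither the lower nor the upper limit.\<close>

definition approx_seq :: "int \<Rightarrow> real \<Rightarrow> nat \<Rightarrow> real" where
  "approx_seq m \<alpha> k =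
     of_int (cf_denom \<alpha> (nat (int k + m))) * dist_Z (of_int (cf_denom \<alpha> k) * \<alpha>)"

text \<open>Limits are taken in the extended reals: for \<open>m \<ge> 2\<close> the upper limit can be infinite.\<close>

definition I_set :: "int \<Rightarrow> ereal set" where
  "I_set m = {liminf (\<lambda>k. ereal (approx_seq m \<alpha> k)) | \<alpha>. \<alpha> \<in> {0..1} - \<rat>}"

definition S_set :: "int \<Rightarrow> ereal set" where
  "S_set m = {limsup (\<lambda>k. ereal (approx_seq m \<alpha> k)) | \<alpha>. \<alpha> \<in> {0..1} - \<rat>}"

definition contains_nondegenerate_interval :: "ereal set \<Rightarrow> bool" where
  "contains_nondegenerate_interval A \<longleftrightarrow> (\<exists>a b :: real. a < b \<and> ereal ` {a..b} \<subseteq> A)"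

text \<open>The denominators satisfy the usual three-term recurrence.\<close>

fun cf_p :: "(nat \<Rightarrow> 'a::comm_ring_1) \<Rightarrow> nat \<Rightarrow> 'a" where
  "cf_p a 0 = a 0"
| "cf_p a (Suc 0) = a 1 * a 0 + 1"
| "cf_p a (Suc (Suc k)) = a (Suc (Suc k)) * cf_p a (Suc k) + cf_p a k"

fun cf_q :: "(nat \<Rightarrow> 'a::comm_ring_1) \<Rightarrow> nat \<Rightarrow> 'a" where
  "cf_q a 0 = 1"
| "cf_q a (Suc 0) = a 1"
| "cf_q a (Suc (Suc k)) = a (Suc (Suc k)) * cf_q a (Suc k) + cf_q a k"

lemma cf_p_cong: "(\<And>i. i \<le> k \<Longrightarrow> a i = b i) \<Longrightarrow> cf_p a k = cf_p b k"
  by (induction a k rule: cf_p.induct) auto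

lemma cf_q_cong: "(\<And>i. i \<le> k \<Longrightarrow> a i = b i) \<Longrightarrow> cf_q a k = cf_q b k"
  by (induction a k rule: cf_q.induct) auto

lemma of_int_cf_p: "of_int (cf_p a k) = cf_p (\<lambda>i. of_int (a i)) k"
  by (induction a k rule: cf_p.induct) auto

lemma of_int_cf_q: "of_int (cf_q a k) = cf_q (\<lambda>i. of_int (a i)) k"
  by (induction a k rule: cf_q.induct) auto

lemma cf_q_pos:
  fixes a :: "nat \<Rightarrow> 'a::linordered_idom"
  assumes "\<And>i. i \<ge> 1 \<Longrightarrow> a i > 0"
  shows "cf_q a k > 0"
  using assms by (induction a k rule: cf_q.induct) (auto intro!: add_pos_pos mult_pos_pos)

lemma cf_det: "cf_p a (Suc k) * cf_q a k - cf_p a k * cf_q a (Suc k) = (- 1) ^ k"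
proof (induction k)
  case (Suc k)
  then show ?case by (simp add: algebra_simps)
qed simp

lemma cf_coprime:
  fixes a :: "nat \<Rightarrow> int"
  shows "coprime (cf_p a k) (cf_q a k)"
proof (rule coprimeI)
  fix d assume "d dvd cf_p a k" "d dvd cf_q a k"
  then have "d dvd cf_p a (Suc k) * cf_q a k - cf_p a k * cf_q a (Suc k)"
    by simp
  then have "d dvd (- 1) ^ k"
    by (simp only: cf_det)
  then show "is_unit d"
    by (cases "even k") auto
qed

lemma cf_eval_snoc2: "cf_eval (xs @ [a, b]) = cf_eval (xs @ [a + 1 / b])"
proof (induction xs rule: cf_eval.induct)
  case (2 x)
  then show ?case by simp
qed auto

lemma cf_eval_eq:
  assumes "\<And>i. i \<ge> 1 \<Longrightarrow> a i > 0"
  shows "cf_eval (map a [0..<Suc k]) = cf_p a k / cf_q a k"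
  using assms
proof (induction k arbitrary: a)
  case (Suc k)
  define b where "b = a(k := a k + 1 / a (Suc k))"
  have pos: "a (Suc k) > 0" using Suc.prems by simp
  have bpos: "b i > 0" if "i \<ge> 1" for i
    using Suc.prems[of i] pos that by (auto simp: b_def intro: add_pos_pos)
  have "map a [0..<k] = map b [0..<k]" by (simp add: b_def)
  then have "cf_eval (map a [0..<Suc (Suc k)]) = cf_eval (map b [0..<Suc k])"
    by (simp add: cf_eval_snoc2 b_def)
  also have "\<dots> = cf_p b k / cf_q b k" using Suc.IH bpos by blast
  also have "\<dots> = cf_p a (Suc k) / cf_q a (Suc k)"
  proof -
    have "cf_p b k = cf_p a (Suc k) / a (Suc k) \<and> cf_q b k = cf_q a (Suc k) / a (Suc k)"
    proof (cases k)
      case 0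
      then show ?thesis using pos by (simp add: b_def field_simps)
    next
      case (Suc l)
      have c: "cf_p b l = cf_p a l" "cf_q b l = cf_q a l"
        by (auto intro!: cf_p_cong cf_q_cong simp: b_def Suc)
      show ?thesis
      proof (cases l)
        case 0
        then show ?thesis using pos Suc by (simp add: b_def field_simps)
      next
        case (Suc j)
        have d: "cf_p b j = cf_p a j" "cf_q b j = cf_q a j"
          by (auto intro!: cf_p_cong cf_q_cong simp: b_def Suc \<open>k = Suc l\<close>)
        show ?thesis
          using pos c d unfolding \<open>k = Suc l\<close> Suc
          by (simp add: b_def \<open>k = Suc l\<close> Suc field_simps)
      qed
    qed
    then show ?thesis using pos by simp
  qed
  finally show ?case .
qed simp

lemma cf_tail_irrational: "\<alpha> \<notin> \<rat> \<Longrightarrow> cf_tail \<alpha> k \<notin> \<rat>"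
proof (induction k)
  case (Suc k)
  have "cf_tail \<alpha> k \<in> \<rat>" if "1 / frac (cf_tail \<alpha> k) \<in> \<rat>"
  proof -
    have "1 / (1 / frac (cf_tail \<alpha> k)) \<in> \<rat>" by (rule Rats_divide[OF Rats_1 that])
    then have "frac (cf_tail \<alpha> k) \<in> \<rat>" by simp
    then have "frac (cf_tail \<alpha> k) + of_int \<lfloor>cf_tail \<alpha> k\<rfloor> \<in> \<rat>"
      by (rule Rats_add) simp
    then show ?thesis by (simp add: frac_def)
  qed
  with Suc show ?case unfolding cf_tail.simps by blast
qed simp

lemma cf_coeff_pos:
  assumes "\<alpha> \<notin> \<rat>" "k \<ge> 1"
  shows "cf_coeff \<alpha> k > 0"
proof -
  obtain l where l: "k = Suc l" using assms(2) by (cases k) auto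
  have "cf_tail \<alpha> l \<notin> \<int>" using cf_tail_irrational[OF assms(1), of l] Ints_subset_Rats by blast
  then have "frac (cf_tail \<alpha> l) > 0" by simp
  then have "1 / frac (cf_tail \<alpha> l) \<ge> 1" using frac_lt_1[of "cf_tail \<alpha> l"] by simp
  then show ?thesis by (simp add: cf_coeff_def l)
qed

lemma cf_denom_eq_cf_q:
  assumes "\<alpha> \<notin> \<rat>"
  shows "cf_denom \<alpha> k = cf_q (cf_coeff \<alpha>) k"
proof -
  have pos: "cf_q (cf_coeff \<alpha>) k > 0" by (intro cf_q_pos cf_coeff_pos assms)
  have "cf_convergent \<alpha> k = Fract (cf_p (cf_coeff \<alpha>) k) (cf_q (cf_coeff \<alpha>) k)"
    unfolding cf_convergent_def
    by (subst cf_eval_eq) (auto simp: Fract_of_int_quotient of_int_cf_p of_int_cf_q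
        intro!: cf_coeff_pos assms)
  then show ?thesis
    using pos cf_coprime[of "cf_coeff \<alpha>" k]
    by (simp add: cf_denom_def quotient_of_Fract normalize_stable)
qed

end

theory Submission
  imports Defs
begin

text \<open>Write \<open>\<alpha> = [0; a\<^sub>1, a\<^sub>2, \<dots>]\<close>.  Up to explicit transformations, the quantity \<open>q\<^sub>k\<^sub>+\<^sub>m \<parallel>q\<^sub>k \<alpha>\<parallel>\<close> depends on a
  bounded number of consecutive digits, the continued fraction \<open>s\<close> of the digits before them, read
  backwards, and the continued fraction \<open>t\<close> of the digits after them.  For \<open>m = -n \<le> 0\<close> it is the reciprocal
  of a form \<open>A + B * s + B' * t + C * s * t\<close> whose coefficients are continuants of \<open>n + 1\<close> digits
  (\<open>approx_seq_nonpos\<close>).  For \<open>m \<ge> 1\<close> it is the continuant of \<open>m - 1\<close> digits plus or minus the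
  reciprocal of such a form for \<open>m + 1\<close> digits (\<open>approx_seq_pos\<close>).

  To prescribe the limit, take a sequence of digits \<open>1, \<dots>, 200\<close> and insert, at sparser and sparser
  positions, copies of a palindrome \<open>W\<close> with huge digits.  For \<open>m \<le> 1\<close> the word \<open>W\<close> is a run of one
  huge digit; for \<open>m \<ge> 2\<close> it is a run of length \<open>m - 1\<close> between two digits \<open>1\<close>.  Away from these spikes
  the quantity stays on the wrong side of its limit along the spikes (\<open>spiked_window_le\<close>,
  \<open>cform_small_digit\<close>), so the spikes alone determine the limit.  If the digits to the right of the spikes
  spell longer and longer parts of a sequence \<open>\<sigma>\<close>, and those to the left spell a sequence \<open>\<tau>\<close>
  backwards, then the form tends to \<open>A + B * (s + t) + C * s * t\<close> with \<open>s = [0; \<tau>]\<close> and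
  \<open>t = [0; \<sigma>]\<close>, where \<open>W\<close> being a palindrome gives \<open>B' = B\<close>.

  What remains is a statement in the style of Hall's theorem on sums of continued fractions: if \<open>s\<close> and
  \<open>t\<close> range over the Cantor set of continued fractions with digits \<open>1, \<dots>, 200\<close>, then this form takes all
  values between its extreme ones (\<open>cf_values_cover\<close>).  The Cantor set is so thick that, whenever a gap
  is removed from one of the two factors, the other factor is long enough to bridge it
  (\<open>interval_cover\<close>); refining the factor with the larger gap keeps this property forever.\<close>

section \<open>Continuants and finite continued fractions\<close>

text \<open>The product of the row vector \<open>(x, y)\<close>, the matrices with rows \<open>(d, 1)\<close> and \<open>(1, 0)\<close> for the digits
  \<open>d\<close> of \<open>w\<close>, and the column vector \<open>(u, v)\<close>.  Euler's continuant of \<open>w\<close> is \<open>cform w 1 0 1 0\<close>.  The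
  boundary vectors stay free because everything below is bilinear in them: \<open>(1, s)\<close> and \<open>(1, t)\<close> carry
  the continued fractions \<open>s\<close> and \<open>t\<close> of the digits before and after \<open>w\<close>.\<close>
fun cform :: "nat list \<Rightarrow> real \<Rightarrow> real \<Rightarrow> real \<Rightarrow> real \<Rightarrow> real" where
  "cform [] x y u v = x * u + y * v"
| "cform (d # w) x y u v = cform w (real d * x + y) x u v"

lemma cform_snoc: "cform (w @ [d]) x y u v = cform w x y (real d * u + v) u"
  by (induction w arbitrary: x y) (auto simp: algebra_simps)

text \<open>The matrices are symmetric, so transposing the product reverses the word and exchanges the
  boundary vectors.  Palindromes therefore give forms that are symmetric in past and future.\<close>
lemma cform_rev: "cform (rev w) x y u v = cform w u v x y"
proof (induction w arbitrary: x y u v)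
  case Nil
  show ?case by simp
next
  case (Cons d w)
  then show ?case by (simp add: cform_snoc)
qed

lemma cform_linear_left:
  "cform w (a * x + b * x') (a * y + b * y') u v = a * cform w x y u v + b * cform w x' y' u v"
proof (induction w arbitrary: x x' y y')
  case Nil
  show ?case by (simp add: algebra_simps)
next
  case (Cons d w)
  have "cform (d # w) (a * x + b * x') (a * y + b * y') u v
      = cform w (a * (d * x + y) + b * (d * x' + y')) (a * x + b * x') u v"
    by (simp add: algebra_simps)
  then show ?case by (simp only: Cons cform.simps)
qed

lemma cform_linear_right:
  "cform w x y (a * u + b * u') (a * v + b * v') = a * cform w x y u v + b * cform w x y u' v'"
  using cform_linear_left[of "rev w" a u b u' v v' x y] by (simp only: cform_rev)

lemma cform_left: "cform w x y u v = x * cform w 1 0 u v + y * cform w 0 1 u v"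
  using cform_linear_left[of w x 1 y 0 0 1 u v] by simp

lemma cform_right: "cform w x y u v = u * cform w x y 1 0 + v * cform w x y 0 1"
  using cform_linear_right[of w x y u 1 v 0 0 1] by simp

lemma cform_nonneg:
  assumes "x \<ge> 0" "y \<ge> 0" "u \<ge> 0" "v \<ge> 0"
  shows "cform w x y u v \<ge> 0"
  using assms by (induction w arbitrary: x y) auto

lemma cform_ge_prod:
  assumes "x \<ge> 0" "y \<ge> 0" "v \<ge> 0"
  shows "cform w x y 1 v \<ge> x * (\<Prod>d\<leftarrow>w. real d)"
  using assms
proof (induction w arbitrary: x y)
  case (Cons d w)
  have prod_nonneg: "0 \<le> (\<Prod>d\<leftarrow>w. real d)" by (rule prod_list_nonneg) auto
  have "x * (\<Prod>d\<leftarrow>d # w. real d) \<le> (d * x + y) * (\<Prod>d\<leftarrow>w. real d)"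
    using mult_nonneg_nonneg[OF Cons.prems(2) prod_nonneg] by (simp add: algebra_simps)
  also have "\<dots> \<le> cform (d # w) x y 1 v" using Cons by simp
  finally show ?case .
qed auto

lemma cform_le_prod:
  assumes "0 \<notin> set w" "0 \<le> y" "y \<le> x" "0 \<le> v" "v \<le> 1"
  shows "cform w x y 1 v \<le> 2 * x * (\<Prod>d\<leftarrow>w. real d + 1)"
  using assms
proof (induction w arbitrary: x y)
  case Nil
  then have "y * v \<le> x * 1" by (intro mult_mono) auto
  then show ?case by simp
next
  case (Cons d w)
  have d: "real d \<ge> 1" using Cons.prems by (cases d) auto
  have x: "1 * x \<le> real d * x" using d Cons.prems by (intro mult_right_mono) auto
  have "cform (d # w) x y 1 v \<le> 2 * (d * x + y) * (\<Prod>d\<leftarrow>w. real d + 1)"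
    unfolding cform.simps using Cons.prems x by (intro Cons.IH) auto
  also have "\<dots> \<le> 2 * ((d + 1) * x) * (\<Prod>d\<leftarrow>w. real d + 1)"
    using Cons.prems by (intro mult_right_mono prod_list_nonneg) (auto simp: algebra_simps)
  finally show ?case by (simp add: algebra_simps)
qed

lemma cform_right_le:
  assumes "0 \<notin> set w" "0 \<le> y" "y \<le> x"
  shows "cform w x y 0 1 \<le> cform w x y 1 0"
  using assms
proof (induction w arbitrary: x y)
  case (Cons d w)
  have "real d \<ge> 1" using Cons.prems by (cases d) auto
  then have "1 * x \<le> real d * x" using Cons.prems by (intro mult_right_mono) auto
  then show ?case unfolding cform.simps using Cons.prems by (intro Cons.IH) auto
qed auto

lemma prod_list_ge_1:
  assumes "0 \<notin> set w"
  shows "(\<Prod>d\<leftarrow>w. real d) \<ge> 1"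
  using assms
proof (induction w)
  case (Cons d w)
  have "real d \<ge> 1" using Cons.prems by (cases d) auto
  then have "1 * 1 \<le> real d * (\<Prod>d\<leftarrow>w. real d)" using Cons by (intro mult_mono) auto
  then show ?case by simp
qed auto

lemma prod_list_le_power:
  assumes "\<And>d. d \<in> set w \<Longrightarrow> d \<le> N"
  shows "(\<Prod>d\<leftarrow>w. real d + 1) \<le> real (N + 1) ^ length w"
  using assms
proof (induction w)
  case (Cons d w)
  then show ?case by (auto intro!: mult_mono prod_list_nonneg)
qed auto

fun cf_map :: "nat list \<Rightarrow> real \<Rightarrow> real" where
  "cf_map [] x = x"
| "cf_map (d # w) x = 1 / (real d + cf_map w x)"

text \<open>\<open>cf_map w\<close> is a Moebius map, and \<open>den w\<close> is its denominator; \<open>den w 0\<close> is the denominator of the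
  convergent with digits \<open>w\<close>.\<close>
definition den :: "nat list \<Rightarrow> real \<Rightarrow> real" where
  "den w x = cform w 1 0 1 x"

lemma cf_map_append: "cf_map (v @ w) x = cf_map v (cf_map w x)"
  by (induction v) auto

lemma cf_map_range:
  assumes "0 \<notin> set w" "x \<in> {0..1}"
  shows "cf_map w x \<in> {0..1}"
  using assms(1)
proof (induction w)
  case (Cons d w)
  have "real d \<ge> 1" using Cons.prems by (cases d) auto
  with Cons show ?case by (auto simp: divide_simps)
qed (use assms in auto)

lemma den_ge_1:
  assumes "0 \<notin> set w" "x \<ge> 0"
  shows "den w x \<ge> 1"
  using cform_ge_prod[of 1 0 x w] prod_list_ge_1[OF assms(1)] assms(2) by (simp add: den_def)

text \<open>Bounded distortion: \<open>den w\<close> is affine with slope between \<open>0\<close> and \<open>den w 0\<close>, so \<open>cf_map w\<close> shrinks all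
  distances in the unit interval by \<open>(den w 0)\<^sup>2\<close>, up to a factor \<open>4\<close>.\<close>
lemma den_bounds:
  assumes "0 \<notin> set w" "x \<in> {0..1}"
  shows "den w 0 \<le> den w x" "den w x \<le> 2 * den w 0"
proof -
  have e: "den w x = den w 0 + x * cform w 1 0 0 1"
    using cform_right[of w 1 0 1 x] by (simp add: den_def)
  have "0 \<le> cform w 1 0 0 1" by (intro cform_nonneg) auto
  moreover have "cform w 1 0 0 1 \<le> den w 0" using assms cform_right_le[of w 0 1] by (simp add: den_def)
  ultimately have "0 \<le> x * cform w 1 0 0 1" "x * cform w 1 0 0 1 \<le> 1 * den w 0"
    using assms mult_mono[of x 1 "cform w 1 0 0 1" "den w 0"] by auto
  with e show "den w 0 \<le> den w x" "den w x \<le> 2 * den w 0" by auto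
qed

lemma cf_map_eq:
  assumes "0 \<notin> set w" "x \<in> {0..1}"
  shows "cf_map w x = cform w 0 1 1 x / den w x"
  using assms(1)
proof (induction w)
  case Nil
  show ?case by (simp add: den_def)
next
  case (Cons d w)
  have pos: "den w x > 0" using den_ge_1[of w x] Cons.prems assms by auto
  have "den (d # w) x = d * den w x + cform w 0 1 1 x"
    using cform_left[of w d 1 1 x] by (simp add: den_def)
  moreover have "cform (d # w) 0 1 1 x = den w x" by (simp add: den_def)
  moreover have "real d + cform w 0 1 1 x / den w x = (d * den w x + cform w 0 1 1 x) / den w x"
    using pos by (simp add: field_simps)
  ultimately show ?case using Cons by simp
qed

lemma den_Cons:
  assumes "0 \<notin> set w" "x \<in> {0..1}"
  shows "den (d # w) x = (real d + cf_map w x) * den w x"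
proof -
  have pos: "den w x > 0" using den_ge_1[of w x] assms by auto
  have "den (d # w) x = d * den w x + cform w 0 1 1 x"
    using cform_left[of w d 1 1 x] by (simp add: den_def)
  then show ?thesis using pos by (simp add: cf_map_eq[OF assms] field_simps)
qed

text \<open>Each step \<open>x \<mapsto> 1 / (d + x)\<close> divides the distance of two points by the product of their two new
  denominators, and these factors multiply up to the values of \<open>den\<close>.\<close>
lemma cf_map_diff:
  assumes "0 \<notin> set w" "x \<in> {0..1}" "y \<in> {0..1}"
  shows "\<bar>cf_map w x - cf_map w y\<bar> = \<bar>x - y\<bar> / (den w x * den w y)"
  using assms(1)
proof (induction w)
  case Nil
  show ?case by (simp add: den_def)
next
  case (Cons d w)
  have w: "0 \<notin> set w" and d: "real d \<ge> 1" using Cons.prems by (auto intro: Suc_leI)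
  let ?X = "real d + cf_map w x" and ?Y = "real d + cf_map w y"
  have pos: "?X > 0" "?Y > 0"
    using cf_map_range[OF w assms(2)] cf_map_range[OF w assms(3)] d by auto
  have "1 / ?X - 1 / ?Y = (?Y - ?X) / (?X * ?Y)" using pos by (simp add: field_simps)
  then have "\<bar>cf_map (d # w) x - cf_map (d # w) y\<bar> = \<bar>cf_map w x - cf_map w y\<bar> / (?X * ?Y)"
    using pos by (simp add: abs_mult abs_minus_commute)
  also have "\<dots> = \<bar>x - y\<bar> / (den w x * den w y) / (?X * ?Y)" using Cons w by simp
  also have "\<dots> = \<bar>x - y\<bar> / (den (d # w) x * den (d # w) y)"
    using den_Cons[OF w] assms by (simp add: mult_ac)
  finally show ?case .
qed

text \<open>Linear growth is far from the truth, but it is enough to make the cylinders shrink to points.\<close>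
lemma den_ge_length:
  assumes "0 \<notin> set w"
  shows "den w 0 \<ge> length w"
  using assms
proof (induction w)
  case (Cons d w)
  have d: "real d \<ge> 1" and w: "0 \<notin> set w" using Cons.prems by (auto intro: Suc_leI)
  have e: "den (d # w) 0 = d * den w 0 + cform w 0 1 1 0"
    using cform_left[of w d 1 1 0] by (simp add: den_def)
  show ?case
  proof (cases w)
    case Nil
    then show ?thesis using d by (simp add: den_def)
  next
    case (Cons c v)
    have "cform w 0 1 1 0 = den v 0" using Cons by (simp add: den_def)
    moreover have "den v 0 \<ge> 1" using w Cons by (intro den_ge_1) auto
    moreover have "1 * den w 0 \<le> d * den w 0" using d den_ge_1[OF w, of 0] by (intro mult_right_mono) auto
    ultimately show ?thesis using Cons.IH[OF w] e by simp
  qed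
qed (simp add: den_def)

lemma cf_map_diff_le:
  assumes "0 \<notin> set w" "x \<in> {0..1}" "y \<in> {0..1}"
  shows "\<bar>cf_map w x - cf_map w y\<bar> * length w \<le> 1"
proof -
  let ?q = "den w 0"
  have q: "?q \<ge> 1" "length w \<le> ?q" using den_ge_1[of w 0] den_ge_length assms by auto
  have "?q * 1 \<le> den w x * den w y"
    using den_bounds[OF assms(1,2)] den_bounds[OF assms(1,3)] q by (intro mult_mono) auto
  then have "\<bar>x - y\<bar> * length w \<le> 1 * (den w x * den w y)"
    using assms q by (intro mult_mono) auto
  moreover have "den w x * den w y > 0"
    using den_ge_1[of w x] den_ge_1[of w y] assms by (intro mult_pos_pos) (auto intro: less_le_trans[of _ 1])
  ultimately show ?thesis unfolding cf_map_diff[OF assms] by (simp add: divide_simps)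
qed

lemma den_snoc_ge:
  assumes "0 \<notin> set w" "i \<ge> 1"
  shows "den (w @ [i]) 0 \<ge> i * den w 0"
proof -
  have "0 \<le> cform w 1 0 0 1" by (intro cform_nonneg) auto
  then show ?thesis
    using cform_right[of w 1 0 "real i" 1] by (simp add: den_def cform_snoc)
qed

lemma den_le_power:
  assumes "0 \<notin> set w" "\<forall>d\<in>set w. d \<le> K"
  shows "den w 0 \<le> 2 * real (K + 1) ^ length w"
proof -
  have "(\<Prod>d\<leftarrow>w. real d + 1) \<le> real (K + 1) ^ length w"
    using assms(2) by (intro prod_list_le_power) auto
  then show ?thesis using cform_le_prod[of w 0 1 0] assms by (simp add: den_def)
qed

section \<open>Values of infinite continued fractions\<close>

definition cf_val :: "(nat \<Rightarrow> nat) \<Rightarrow> real" where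
  "cf_val a = lim (\<lambda>n. cf_map (map a [0..<n]) 0)"

lemma map_upt_add: "map a [0..<n + k] = map a [0..<n] @ map (\<lambda>i. a (n + i)) [0..<k]"
  by (rule nth_equalityI) (auto simp: nth_append)

lemma zero_notin_map_upt:
  assumes "\<And>i. a i \<ge> (1::nat)"
  shows "0 \<notin> set (map a [0..<n])"
proof
  assume "0 \<in> set (map a [0..<n])"
  then obtain i where "a i = 0" by auto
  with assms[of i] show False by simp
qed

lemma cf_val_LIMSEQ:
  assumes "\<And>i. a i \<ge> 1"
  shows "(\<lambda>n. cf_map (map a [0..<n]) 0) \<longlonglongrightarrow> cf_val a"
proof -
  let ?c = "\<lambda>n. cf_map (map a [0..<n]) 0"
  have *: "\<bar>?c (n + k) - ?c n\<bar> * n \<le> 1" for n k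
  proof -
    have z: "0 \<notin> set (map a [0..<n])" by (rule zero_notin_map_upt) (rule assms)
    have z': "0 \<notin> set (map (\<lambda>i. a (n + i)) [0..<k])"
      by (rule zero_notin_map_upt) (rule assms)
    have "?c (n + k) = cf_map (map a [0..<n]) (cf_map (map (\<lambda>i. a (n + i)) [0..<k]) 0)"
      by (simp only: map_upt_add cf_map_append)
    then show ?thesis
      using cf_map_diff_le[OF z cf_map_range[OF z', of 0], of 0] by simp
  qed
  have "Cauchy ?c"
  proof (rule metric_CauchyI)
    fix e :: real assume e: "e > 0"
    obtain N :: nat where N: "2 / e < N" using reals_Archimedean2 by blast
    have N0: "N > 0" using N e by (metis divide_pos_pos less_trans of_nat_0_less_iff zero_less_numeral)
    have c: "dist (?c n) (?c N) < e / 2" if "n \<ge> N" for n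
    proof -
      have "\<bar>?c n - ?c N\<bar> * N \<le> 1" using *[of N "n - N"] that by simp
      moreover have "1 < e / 2 * N" using N e by (simp add: field_simps)
      ultimately have "\<bar>?c n - ?c N\<bar> * N < e / 2 * N" by linarith
      then show ?thesis using N0 by (simp add: dist_real_def)
    qed
    show "\<exists>M. \<forall>m\<ge>M. \<forall>n\<ge>M. dist (?c m) (?c n) < e"
      using c dist_triangle_half_l by blast
  qed
  then show ?thesis
    unfolding cf_val_def by (simp add: Cauchy_convergent convergent_LIMSEQ_iff[symmetric])
qed

lemma cf_val_range:
  assumes "\<And>i. a i \<ge> 1"
  shows "cf_val a \<in> {0..1}"
proof (rule closed_sequentially[OF closed_atLeastAtMost])
  show "cf_map (map a [0..<n]) 0 \<in> {0..1}" for n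
    by (intro cf_map_range zero_notin_map_upt) (use assms in auto)
  show "(\<lambda>n. cf_map (map a [0..<n]) 0) \<longlonglongrightarrow> cf_val a"
    by (rule cf_val_LIMSEQ) (rule assms)
qed

lemma cf_val_unfold:
  assumes "\<And>i. a i \<ge> 1"
  shows "cf_val a = 1 / (real (a 0) + cf_val (\<lambda>i. a (Suc i)))"
proof -
  let ?b = "\<lambda>i. a (Suc i)"
  have b: "?b i \<ge> 1" for i by (rule assms)
  have e: "cf_map (map a [0..<Suc n]) 0 = 1 / (real (a 0) + cf_map (map ?b [0..<n]) 0)" for n
  proof -
    have "map a [0..<Suc n] = a 0 # map ?b [0..<n]"
      using map_upt_add[of a 1 n] by simp
    then show ?thesis by simp
  qed
  have "real (a 0) + cf_val ?b \<noteq> 0" using cf_val_range[of ?b, OF b] assms[of 0] by auto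
  then have "(\<lambda>n. 1 / (real (a 0) + cf_map (map ?b [0..<n]) 0)) \<longlonglongrightarrow> 1 / (real (a 0) + cf_val ?b)"
    by (intro tendsto_intros cf_val_LIMSEQ b)
  then have "(\<lambda>n. cf_map (map a [0..<Suc n]) 0) \<longlonglongrightarrow> 1 / (real (a 0) + cf_val ?b)"
    by (simp only: e)
  moreover have "(\<lambda>n. cf_map (map a [0..<Suc n]) 0) \<longlonglongrightarrow> cf_val a"
    by (rule LIMSEQ_Suc[OF cf_val_LIMSEQ]) (rule assms)
  ultimately show ?thesis using LIMSEQ_unique by blast
qed

lemma cf_val_prefix:
  assumes "\<And>i. a i \<ge> 1"
  shows "cf_val a = cf_map (map a [0..<n]) (cf_val (\<lambda>i. a (n + i)))"
proof (induction n)
  case (Suc n)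
  have "cf_val (\<lambda>i. a (n + i)) = 1 / (real (a (n + 0)) + cf_val (\<lambda>i. a (n + Suc i)))"
    by (rule cf_val_unfold) (rule assms)
  then show ?case using Suc by (simp add: cf_map_append)
qed simp

lemma cf_val_near:
  assumes "\<And>i. a i \<ge> 1" "x \<in> {0..1}"
  shows "\<bar>cf_map (map a [0..<n]) x - cf_val a\<bar> * n \<le> 1"
proof -
  have z: "0 \<notin> set (map a [0..<n])" by (rule zero_notin_map_upt) (rule assms)
  have "cf_val (\<lambda>i. a (n + i)) \<in> {0..1}" by (rule cf_val_range) (rule assms)
  from cf_map_diff_le[OF z assms(2) this] show ?thesis
    using cf_val_prefix[of a n] assms(1) by simp
qed

lemma cf_val_in_open: 
  assumes "\<And>i. a i \<ge> 1"
  shows "0 < cf_val a" "cf_val a < 1"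
proof -
  have pos: "0 < cf_val b" if b: "\<And>i. b i \<ge> 1" for b
  proof -
    have "cf_val (\<lambda>i. b (Suc i)) \<in> {0..1}" by (rule cf_val_range) (rule b)
    moreover have "real (b 0) \<ge> 1" using b[of 0] by simp
    ultimately show ?thesis unfolding cf_val_unfold[of b, OF b] by auto
  qed
  show "0 < cf_val a" by (rule pos) (rule assms)
  have "0 < cf_val (\<lambda>i. a (Suc i))" by (rule pos) (rule assms)
  moreover have "real (a 0) \<ge> 1" using assms[of 0] by simp
  ultimately show "cf_val a < 1" unfolding cf_val_unfold[of a, OF assms] by auto
qed

text \<open>Infinite descent: if the value were \<open>p / q\<close>, then the value with the first digit removed would be
  a nonnegative fraction with the denominator \<open>p < q\<close>.\<close>
lemma cf_val_irrational:
  assumes "\<And>i. a i \<ge> 1"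
  shows "cf_val a \<notin> \<rat>"
proof -
  have "cf_val a * real q \<noteq> real p" if "\<And>i. a i \<ge> 1" "q > 0" for a p q
    using that
  proof (induction q arbitrary: a p rule: less_induct)
    case (less q)
    show ?case
    proof
      assume e: "cf_val a * real q = real p"
      let ?b = "\<lambda>i. a (Suc i)"
      note o = cf_val_in_open[of a, OF less.prems(1)]
      have p: "0 < p" using o e less.prems(2)
        by (metis mult_pos_pos of_nat_0_less_iff)
      have "real p < real q" using e o less.prems(2)
        by (metis mult_less_cancel_right_pos mult_1 of_nat_0_less_iff)
      then have pq: "p < q" by simp
      have b: "cf_val ?b \<ge> 0" using cf_val_range[of ?b] less.prems(1) by auto
      have "real (a 0) \<ge> 1" using less.prems(1)[of 0] by simp
      then have "(real (a 0) + cf_val ?b) * real p = real q"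
        using e b unfolding cf_val_unfold[of a, OF less.prems(1)] by (simp add: field_simps)
      then have f: "cf_val ?b * real p = real q - real (a 0) * real p" by (simp add: algebra_simps)
      then have "real q - real (a 0) * real p \<ge> 0" using b by (metis mult_nonneg_nonneg of_nat_0_le_iff)
      then have "real (a 0 * p) \<le> real q" by simp
      then have "a 0 * p \<le> q" by (simp only: of_nat_le_iff)
      then have "cf_val ?b * real p = real (q - a 0 * p)" using f by (simp add: of_nat_diff)
      with less.IH[OF pq, of ?b] less.prems(1) p show False by blast
    qed
  qed
  note * = this[of a, OF assms]
  show ?thesis
  proof
    assume "cf_val a \<in> \<rat>"
    then obtain m n where "n \<noteq> 0" "\<bar>cf_val a\<bar> = real m / real n"
      using Rats_abs_nat_div_natE by metis
    then show False using *[of n m] cf_val_in_open[of a] assms by (simp add: field_simps)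
  qed
qed

section \<open>Thick Cantor sets of continued fractions\<close>

text \<open>The values of continued fractions with all digits in \<open>{1..K}\<close> form a Cantor set with minimum
  \<open>\<alpha> = [0; K, 1, K, 1, \<dots>]\<close> and maximum \<open>\<beta> = [0; 1, K, 1, K, \<dots>]\<close>.  In the coordinate
  \<open>1 / x\<close>, a cylinder of a digit has length \<open>\<beta> - \<alpha>\<close> and the gap to the next one has length
  \<open>1 - (\<beta> - \<alpha>)\<close>, so the assumption \<open>thick\<close> says that the gaps are short compared with what lies next to
  them.  The constant is \<open>72 = 2 * 4 * 9\<close>: the factor \<open>2\<close> is needed for the sum-like functions
  of \<open>interval_cover\<close>, the factor \<open>4\<close> is the distortion of \<open>cf_map\<close>, and \<open>9\<close> bounds
  \<open>((i + 1 + \<beta>) / i)\<^sup>2\<close>.\<close>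
locale thick_digits =
  fixes K :: nat and \<alpha> \<beta> :: real
  assumes K_ge_2: "K \<ge> 2"
    and \<alpha>_pos: "0 < \<alpha>"
    and \<beta>_eq: "\<beta> = 1 / (1 + \<alpha>)"
    and \<alpha>_eq: "\<alpha> = 1 / (K + \<beta>)"
    and thick: "72 * (1 - (\<beta> - \<alpha>)) \<le> \<beta> - \<alpha>"
begin

text \<open>The piece \<open>(w, i, j)\<close> is the hull of the values whose digits begin with \<open>w\<close> followed by a digit in
  \<open>{i..j}\<close>.  Splitting off one digit at a time, instead of all \<open>K\<close> digits at once, is what keeps the
  parts long in comparison with the gap between them.\<close>
type_synonym piece = "nat list \<times> nat \<times> nat"

definition piece_set :: "piece \<Rightarrow> real set" where
  "piece_set = (\<lambda>(w, i, j). cf_map w ` {1 / (j + \<beta>)..1 / (i + \<alpha>)})"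

definition valid :: "piece \<Rightarrow> bool" where
  "valid = (\<lambda>(w, i, j). set w \<subseteq> {1..K} \<and> 1 \<le> i \<and> i < j \<and> j \<le> K)"

text \<open>An upper bound for the length of the gap that opens between the digit \<open>i\<close> and the digits above it.
  The exact length need not be monotone under refinement because of the distortion; this bound is, and
  it is still smaller than the neighbouring pieces.\<close>
definition gap :: "piece \<Rightarrow> real" where
  "gap = (\<lambda>(w, i, j). (1 - (\<beta> - \<alpha>)) / (i * den w 0)\<^sup>2)"

text \<open>Each refinement increases this number: either the word grows, or the lower digit does, which is at
  most \<open>K\<close>.\<close>
definition depth :: "piece \<Rightarrow> nat" where
  "depth = (\<lambda>(w, i, j). length w * K + i)"

definition spans :: "real set \<Rightarrow> real \<Rightarrow> bool" where
  "spans S r \<longleftrightarrow> (\<exists>p\<in>S. \<exists>q\<in>S. q - p \<ge> r)"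

definition extends :: "piece \<Rightarrow> piece \<Rightarrow> bool" where
  "extends c c' \<longleftrightarrow> (\<exists>v. fst c' = fst c @ v)"

lemma \<beta>_less_1: "\<beta> < 1" and \<alpha>_less_\<beta>: "\<alpha> < \<beta>"
proof -
  show "\<beta> < 1" using \<alpha>_pos by (simp add: \<beta>_eq)
  show "\<alpha> < \<beta>" using thick by (simp add: algebra_simps)
qed

lemma valid_zero: "valid (w, i, j) \<Longrightarrow> 0 \<notin> set w"
  by (auto simp: valid_def)

lemma param_range:
  assumes "i \<ge> (1::nat)" "0 \<le> (a::real)"
  shows "1 / (i + a) \<in> {0..1}"
  using assms by (simp add: divide_simps)

lemma piece_param:
  assumes "valid (w, i, j)" "z \<in> {1 / (j + \<beta>)..1 / (i + \<alpha>)}"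
  shows "z \<in> {0..1}"
proof -
  have "i \<ge> 1" "j \<ge> 1" using assms by (auto simp: valid_def)
  then have "1 / (j + \<beta>) \<in> {0..1}" "1 / (i + \<alpha>) \<in> {0..1}"
    using \<alpha>_pos \<alpha>_less_\<beta> param_range[of j \<beta>] param_range[of i \<alpha>] by auto
  with assms(2) show ?thesis by (meson atLeastAtMost_iff order_trans)
qed

lemma piece_subset: "valid c \<Longrightarrow> piece_set c \<subseteq> {0..1}"
  using piece_param cf_map_range valid_zero unfolding piece_set_def
  by (cases c) (auto simp del: atLeastAtMost_iff)

lemma continuous_on_cf_map:
  assumes "0 \<notin> set w"
  shows "continuous_on {0..1} (cf_map w)"
  using assms
proof (induction w)
  case (Cons d w)
  have d: "real d \<ge> 1" and w: "0 \<notin> set w" using Cons.prems by (auto intro: Suc_leI)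
  have "real d + cf_map w x \<noteq> 0" if "x \<in> {0..1}" for x
    using cf_map_range[OF w that] d by auto
  then show ?case using Cons.IH[OF w] by (auto intro!: continuous_intros)
qed (auto intro: continuous_intros)

lemma connected_piece: "valid c \<Longrightarrow> connected (piece_set c)"
  by (cases c) (auto simp: piece_set_def intro!: connected_continuous_image
    continuous_on_subset[OF continuous_on_cf_map] valid_zero piece_param simp del: atLeastAtMost_iff)

lemma cf_map_between:
  assumes "0 \<notin> set w" "0 \<le> x" "x \<le> y" "y \<le> z" "z \<le> 1"
  shows "cf_map w y \<in> closed_segment (cf_map w x) (cf_map w z)"
  using assms(1)
proof (induction w)
  case Nil
  then show ?case using assms by (auto simp: closed_segment_eq_real_ivl)
next
  case (Cons d w)
  have d: "real d \<ge> 1" and w: "0 \<notin> set w" using Cons.prems by (auto intro: Suc_leI)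
  have r: "cf_map w x \<in> {0..1}" "cf_map w y \<in> {0..1}" "cf_map w z \<in> {0..1}"
    using assms by (auto intro!: cf_map_range w simp del: atLeastAtMost_iff) auto
  have anti: "1 / (d + t) \<le> 1 / (d + s)" if "s \<le> t" "0 \<le> s" for s t :: real
    using that d by (intro divide_left_mono mult_pos_pos) auto
  show ?case
  proof (cases "cf_map w x \<le> cf_map w z")
    case True
    then have "cf_map w x \<le> cf_map w y" "cf_map w y \<le> cf_map w z"
      using Cons.IH[OF w] by (auto simp: closed_segment_eq_real_ivl)
    from this[THEN anti] r show ?thesis by (auto simp: closed_segment_eq_real_ivl)
  next
    case False
    then have "cf_map w z \<le> cf_map w y" "cf_map w y \<le> cf_map w x"
      using Cons.IH[OF w] by (auto simp: closed_segment_eq_real_ivl)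
    from this[THEN anti] r show ?thesis by (auto simp: closed_segment_eq_real_ivl)
  qed
qed

lemma spans_mono: "spans S r \<Longrightarrow> r' \<le> r \<Longrightarrow> S \<subseteq> S' \<Longrightarrow> spans S' r'"
  unfolding spans_def by (meson order_trans subsetD)

lemma spans_image:
  assumes "0 \<notin> set w" "x \<in> {0..1}" "y \<in> {0..1}" "x \<in> Z" "y \<in> Z" "r * (2 * den w 0)\<^sup>2 \<le> \<bar>x - y\<bar>" "r \<ge> 0"
  shows "spans (cf_map w ` Z) r"
proof -
  let ?d = "\<bar>cf_map w x - cf_map w y\<bar>"
  have q: "den w 0 \<ge> 1" "den w x \<ge> 1" "den w y \<ge> 1"
    using den_ge_1[of w] assms by auto
  have p: "den w x * den w y \<le> (2 * den w 0)\<^sup>2" unfolding power2_eq_square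
    using den_bounds[OF assms(1,2)] den_bounds[OF assms(1,3)] q by (intro mult_mono) auto
  have "r * (den w x * den w y) \<le> \<bar>x - y\<bar>"
    using mult_left_mono[OF p assms(7)] assms(6) by linarith
  moreover have "den w x * den w y > 0" using q by (intro mult_pos_pos) auto
  ultimately have "r \<le> ?d" unfolding cf_map_diff[OF assms(1-3)] by (simp add: pos_le_divide_eq)
  then have "r \<le> cf_map w x - cf_map w y \<or> r \<le> cf_map w y - cf_map w x" by linarith
  then show ?thesis unfolding spans_def using assms(4,5) by blast
qed

lemma piece_snoc:
  assumes "i \<ge> 1"
  shows "piece_set (w @ [i], 1, K) = cf_map w ` {1 / (i + \<beta>)..1 / (i + \<alpha>)}"
proof -
  have "(\<lambda>x. 1 / (real i + x)) ` {\<alpha>..\<beta>} = {1 / (i + \<beta>)..1 / (i + \<alpha>)}"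
  proof (intro equalityI subsetI)
    fix z assume "z \<in> (\<lambda>x. 1 / (real i + x)) ` {\<alpha>..\<beta>}"
    then obtain x :: real where x: "z = 1 / (i + x)" "\<alpha> \<le> x" "x \<le> \<beta>" by auto
    then show "z \<in> {1 / (i + \<beta>)..1 / (i + \<alpha>)}"
      using \<alpha>_pos by (auto intro!: divide_left_mono mult_pos_pos)
  next
    fix z assume z: "z \<in> {1 / (i + \<beta>)..1 / (i + \<alpha>)}"
    have "0 < 1 / (i + \<beta>)" using \<alpha>_pos \<alpha>_less_\<beta> by (auto intro!: divide_pos_pos)
    then have zp: "z > 0" using z by (meson atLeastAtMost_iff less_le_trans)
    have "1 \<le> z * (i + \<beta>)" "z * (i + \<alpha>) \<le> 1"
      using z \<alpha>_pos \<alpha>_less_\<beta> assms by (auto simp: divide_simps split: if_splits)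
    then have "1 / z - i \<in> {\<alpha>..\<beta>}" using zp by (auto simp: field_simps)
    moreover have "z = 1 / (real i + (1 / z - i))" using zp by simp
    ultimately show "z \<in> (\<lambda>x. 1 / (real i + x)) ` {\<alpha>..\<beta>}" by blast
  qed
  moreover have "{1 / (K + \<beta>)..1 / (real 1 + \<alpha>)} = {\<alpha>..\<beta>}"
    using \<alpha>_eq \<beta>_eq by simp
  moreover have "cf_map (w @ [i]) = cf_map w \<circ> (\<lambda>x. 1 / (real i + x))"
    by (auto simp: cf_map_append)
  ultimately show ?thesis
    unfolding piece_set_def prod.case by (simp only: image_comp[symmetric])
qed

lemma gap_nonneg: "gap c \<ge> 0"
  using \<alpha>_pos \<beta>_less_1 by (cases c) (auto simp: gap_def)

lemma gap_antimono:
  assumes "valid (w, i, j)" "i * den w 0 \<le> i' * den w' 0"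
  shows "gap (w', i', j') \<le> gap (w, i, j)"
proof -
  have "i \<ge> 1" "den w 0 \<ge> 1" using assms valid_zero den_ge_1 by (auto simp: valid_def)
  then have pos: "0 < i * den w 0" by auto
  then have "0 < (i' * den w' 0)\<^sup>2" using assms(2) by (intro zero_less_power) linarith
  then show ?thesis using pos assms(2) \<alpha>_pos \<beta>_less_1
    unfolding gap_def prod.case
    by (intro divide_left_mono power_mono mult_pos_pos[OF _ zero_less_power]) (assumption | simp)+
qed

lemma spans_digit:
  fixes l :: nat
  assumes w: "valid (w, i, j)" and l: "l = i \<or> l = i + 1"
  shows "spans (cf_map w ` {1 / (l + \<beta>)..1 / (l + \<alpha>)}) (2 * gap (w, i, j))"
proof (rule spans_image[where x = "1 / (l + \<beta>)" and y = "1 / (l + \<alpha>)"])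
  have i: "real i \<ge> 1" using w by (auto simp: valid_def)
  then have l1: "l \<ge> 1" and l2: "real l \<le> 2 * real i" "real l \<ge> 1" using l by auto
  show "0 \<notin> set w" by (rule valid_zero[OF w])
  show "1 / (l + \<beta>) \<in> {0..1}" "1 / (l + \<alpha>) \<in> {0..1}"
    using l1 \<alpha>_pos \<alpha>_less_\<beta> param_range[of l \<beta>] param_range[of l \<alpha>] by auto
  have le: "1 / (l + \<beta>) \<le> 1 / (l + \<alpha>)"
    using \<alpha>_pos \<alpha>_less_\<beta> by (auto intro!: divide_left_mono mult_pos_pos)
  then show "1 / (l + \<beta>) \<in> {1 / (l + \<beta>)..1 / (l + \<alpha>)}" "1 / (l + \<alpha>) \<in> {1 / (l + \<beta>)..1 / (l + \<alpha>)}"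
    by auto
  have q: "den w 0 \<ge> 1" using valid_zero[OF w] den_ge_1 by simp
  have "2 * gap (w, i, j) * (2 * den w 0)\<^sup>2 = 8 * (1 - (\<beta> - \<alpha>)) / (real i)\<^sup>2"
    using q by (simp add: gap_def power_mult_distrib divide_simps)
  also have "\<dots> \<le> (\<beta> - \<alpha>) / 9 / (real i)\<^sup>2"
    using thick by (intro divide_right_mono) auto
  also have "\<dots> \<le> (\<beta> - \<alpha>) / ((l + \<beta>) * (l + \<alpha>))"
  proof -
    have "(l + \<beta>) * (l + \<alpha>) \<le> (3 * real i) * (3 * real i)"
    proof (intro mult_mono)
      show "l + \<beta> \<le> 3 * real i" "l + \<alpha> \<le> 3 * real i"
        using l2 i \<beta>_less_1 \<alpha>_less_\<beta> by linarith+
    qed (use \<alpha>_pos \<alpha>_less_\<beta> in auto)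
    then have "(\<beta> - \<alpha>) / (9 * (real i)\<^sup>2) \<le> (\<beta> - \<alpha>) / ((l + \<beta>) * (l + \<alpha>))"
      using l2 i \<alpha>_pos \<alpha>_less_\<beta> by (intro divide_left_mono mult_pos_pos) (auto simp: power2_eq_square)
    then show ?thesis by simp
  qed
  also have "\<dots> = 1 / (l + \<alpha>) - 1 / (l + \<beta>)"
    using l2 \<alpha>_pos \<alpha>_less_\<beta> by (simp add: field_simps)
  also have "\<dots> = \<bar>1 / (l + \<beta>) - 1 / (l + \<alpha>)\<bar>" using le by simp
  finally show "2 * gap (w, i, j) * (2 * den w 0)\<^sup>2 \<le> \<bar>1 / (l + \<beta>) - 1 / (l + \<alpha>)\<bar>" .
  show "0 \<le> 2 * gap (w, i, j)" using gap_nonneg by simp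
qed

text \<open>One refinement step: the digit \<open>i\<close> is split off.  A part that contains a single digit \<open>l\<close> is
  rewritten as the piece with the longer word \<open>w @ [l]\<close> and the full digit range, which is the same set by
  \<open>piece_snoc\<close>.  Each point of the piece lies in a part or in the gap between them.\<close>
lemma split_piece:
  assumes c: "valid c"
  obtains c\<^sub>1 c\<^sub>2 where
    "\<And>e. e \<in> {c\<^sub>1, c\<^sub>2} \<Longrightarrow> valid e \<and> extends c e \<and> gap e \<le> gap c \<and> depth c < depth e
        \<and> spans (piece_set e) (2 * gap c)"
    "\<And>x. x \<in> piece_set c \<Longrightarrow> \<exists>a b. a \<in> piece_set c\<^sub>1 \<union> piece_set c\<^sub>2 \<and> b \<in> piece_set c\<^sub>1 \<union> piece_set c\<^sub>2
        \<and> x \<in> closed_segment a b \<and> \<bar>a - b\<bar> \<le> gap c"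
proof -
  obtain w i j where e: "c = (w, i, j)" by (cases c)
  have v: "valid (w, i, j)" and w: "0 \<notin> set w" "set w \<subseteq> {1..K}" and ij: "1 \<le> i" "i < j" "j \<le> K"
    using c valid_zero[of w i j] by (auto simp: e valid_def)
  have q: "den w 0 \<ge> 1" using w den_ge_1 by simp
  define c\<^sub>1 where "c\<^sub>1 = (w @ [i], 1::nat, K)"
  define c\<^sub>2 where "c\<^sub>2 = (if i + 1 < j then (w, i + 1, j) else (w @ [j], 1::nat, K))"
  have s1: "piece_set c\<^sub>1 = cf_map w ` {1 / (i + \<beta>)..1 / (i + \<alpha>)}"
    unfolding c\<^sub>1_def using ij by (intro piece_snoc) auto
  have s2: "piece_set c\<^sub>2 = cf_map w ` {1 / (j + \<beta>)..1 / (real i + 1 + \<alpha>)}"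
  proof (cases "i + 1 < j")
    case True
    then show ?thesis by (simp add: c\<^sub>2_def piece_set_def add_ac)
  next
    case False
    then have "j = i + 1" using ij by simp
    then show ?thesis using piece_snoc[of j w] by (simp add: c\<^sub>2_def add_ac)
  qed
  have snoc: "valid (w @ [l], 1, K) \<and> extends c (w @ [l], 1, K) \<and> gap (w @ [l], 1, K) \<le> gap c
      \<and> depth c < depth (w @ [l], 1, K)" if l: "l \<in> {i..j}" for l :: nat
  proof (intro conjI)
    show "valid (w @ [l], 1, K)" using w ij l K_ge_2 by (auto simp: valid_def)
    show "extends c (w @ [l], 1, K)" by (auto simp: extends_def e)
    have "i * den w 0 \<le> l * den w 0" using l q by (intro mult_right_mono) auto
    also have "\<dots> \<le> den (w @ [l]) 0" using l ij w by (intro den_snoc_ge) auto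
    finally show "gap (w @ [l], 1, K) \<le> gap c"
      unfolding e by (intro gap_antimono v) simp
    show "depth c < depth (w @ [l], 1, K)" using ij by (simp add: e depth_def)
  qed
  have "valid e \<and> extends c e \<and> gap e \<le> gap c \<and> depth c < depth e \<and> spans (piece_set e) (2 * gap c)"
    if "e \<in> {c\<^sub>1, c\<^sub>2}" for e
  proof (cases "e = c\<^sub>1")
    case True
    then show ?thesis using snoc[of i] ij spans_digit[OF v, of i] s1 by (simp add: c\<^sub>1_def e)
  next
    case False
    with that have e2: "e = c\<^sub>2" by simp
    have "spans (piece_set c\<^sub>2) (2 * gap c)"
    proof (rule spans_mono)
      show "spans (cf_map w ` {1 / (real (i + 1) + \<beta>)..1 / (real (i + 1) + \<alpha>)}) (2 * gap c)"
        unfolding e using spans_digit[OF v, of "i + 1"] by simp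
      have "1 / (j + \<beta>) \<le> 1 / (real (i + 1) + \<beta>)"
        using ij \<alpha>_pos \<alpha>_less_\<beta> by (intro divide_left_mono mult_pos_pos) auto
      then show "cf_map w ` {1 / (real (i + 1) + \<beta>)..1 / (real (i + 1) + \<alpha>)} \<subseteq> piece_set c\<^sub>2"
        unfolding s2 by (intro image_mono) (auto simp: add_ac)
    qed simp
    moreover have "valid c\<^sub>2 \<and> extends c c\<^sub>2 \<and> gap c\<^sub>2 \<le> gap c \<and> depth c < depth c\<^sub>2"
    proof (cases "i + 1 < j")
      case True
      have "gap c\<^sub>2 \<le> gap c"
        using True q unfolding c\<^sub>2_def e by (auto intro!: gap_antimono v mult_right_mono)
      then show ?thesis using True w ij by (auto simp: c\<^sub>2_def valid_def extends_def depth_def e)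
    next
      case False
      then show ?thesis using snoc[of j] ij by (simp add: c\<^sub>2_def)
    qed
    ultimately show ?thesis using e2 by simp
  qed
  moreover have "\<exists>a b. a \<in> piece_set c\<^sub>1 \<union> piece_set c\<^sub>2 \<and> b \<in> piece_set c\<^sub>1 \<union> piece_set c\<^sub>2
        \<and> x \<in> closed_segment a b \<and> \<bar>a - b\<bar> \<le> gap c" if x: "x \<in> piece_set c" for x
  proof -
    obtain z where z: "z \<in> {1 / (j + \<beta>)..1 / (i + \<alpha>)}" "x = cf_map w z"
      using x by (auto simp: e piece_set_def)
    show ?thesis
    proof (cases "x \<in> piece_set c\<^sub>1 \<union> piece_set c\<^sub>2")
      case True
      then show ?thesis using gap_nonneg by (intro exI[of _ x]) auto
    next
      case False
      let ?a = "1 / (real i + 1 + \<alpha>)" and ?b = "1 / (i + \<beta>)"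
      have zg: "?a \<le> z" "z \<le> ?b" using False z by (auto simp: s1 s2)
      have r: "?a \<in> {0..1}" "?b \<in> {0..1}"
        using ij \<alpha>_pos \<alpha>_less_\<beta> param_range[of i \<beta>] param_range[of "i + 1" \<alpha>]
        by (auto simp: add_ac simp del: atLeastAtMost_iff)
      have "1 / (j + \<beta>) \<le> ?a"
        using ij \<alpha>_pos \<alpha>_less_\<beta> by (intro divide_left_mono mult_pos_pos) auto
      then have a: "cf_map w ?a \<in> piece_set c\<^sub>2" unfolding s2 by (intro imageI) auto
      have "?b \<le> 1 / (i + \<alpha>)"
        using ij \<alpha>_pos \<alpha>_less_\<beta> by (intro divide_left_mono mult_pos_pos) auto
      then have b: "cf_map w ?b \<in> piece_set c\<^sub>1" unfolding s1 by (intro imageI) auto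
      have "\<bar>cf_map w ?a - cf_map w ?b\<bar> = \<bar>?a - ?b\<bar> / (den w ?a * den w ?b)"
        by (intro cf_map_diff w r)
      also have "\<dots> \<le> \<bar>?a - ?b\<bar> / (den w 0 * den w 0)"
        using den_bounds(1)[OF w(1) r(1)] den_bounds(1)[OF w(1) r(2)] q
        by (intro divide_left_mono mult_mono mult_pos_pos) auto
      also have "\<bar>?a - ?b\<bar> \<le> (1 - (\<beta> - \<alpha>)) / (real i)\<^sup>2"
      proof -
        have "\<bar>?a - ?b\<bar> = ?b - ?a" using zg by simp
        also have "\<dots> = (1 - (\<beta> - \<alpha>)) / ((i + \<beta>) * (i + 1 + \<alpha>))"
          using ij \<alpha>_pos \<alpha>_less_\<beta> by (simp add: divide_simps) (simp add: algebra_simps)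
        also have "\<dots> \<le> (1 - (\<beta> - \<alpha>)) / (real i * real i)"
          using ij \<alpha>_pos \<alpha>_less_\<beta> \<beta>_less_1 by (intro divide_left_mono mult_mono mult_pos_pos) auto
        finally show ?thesis by (simp add: power2_eq_square)
      qed
      finally have "\<bar>cf_map w ?a - cf_map w ?b\<bar> \<le> (1 - (\<beta> - \<alpha>)) / (real i)\<^sup>2 / (den w 0 * den w 0)"
        using q by (simp add: divide_right_mono)
      then have "\<bar>cf_map w ?a - cf_map w ?b\<bar> \<le> gap c"
        by (simp add: gap_def e power_mult_distrib power2_eq_square mult_ac)
      moreover have "x \<in> closed_segment (cf_map w ?a) (cf_map w ?b)"
        unfolding z(2) using zg r by (intro cf_map_between w) auto
      ultimately show ?thesis using a b by blast
    qed
  qed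
  ultimately show ?thesis using that by blast
qed

end

text \<open>Why a gap can be removed without losing a value: let \<open>x\<close> lie in the gap from \<open>a\<close> to \<open>b\<close>.  The
  value \<open>f x y\<close> lies between \<open>f a y\<close> and \<open>f b y\<close>, and the intervals \<open>f a ` J\<close> and \<open>f b ` J\<close> overlap as soon as
  \<open>J\<close> is twice as long as the gap, since the two partial derivatives of \<open>f\<close> both lie between \<open>B\<close> and
  \<open>2 * B\<close>.  So the value is attained over an endpoint of the gap.\<close>
lemma interval_cover:
  fixes A B C :: real
  assumes f: "f = (\<lambda>s t. A + B * (s + t) + C * s * t)" and BC: "0 \<le> C" "C \<le> B"
    and x: "x \<in> closed_segment a b" "a \<in> {0..1}" "b \<in> {0..1}"
    and J: "connected J" "J \<subseteq> {0..1}" "y \<in> J" "p \<in> J" "q \<in> J" "q - p \<ge> 2 * \<bar>a - b\<bar>"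
  shows "\<exists>x'\<in>{a, b}. \<exists>y'\<in>J. f x' y' = f x y"
proof -
  have ivt: "\<exists>y'\<in>J. f s y' = z" if "y\<^sub>1 \<in> J" "y\<^sub>2 \<in> J" "f s y\<^sub>1 \<le> z" "z \<le> f s y\<^sub>2" for s z y\<^sub>1 y\<^sub>2
  proof -
    have "continuous_on J (f s)" unfolding f by (intro continuous_intros)
    then have "connected (f s ` J)" using J(1) by (intro connected_continuous_image)
    then have "z \<in> f s ` J" using that connectedD_interval by blast
    then show ?thesis by auto
  qed
  have *: "\<exists>x'\<in>{a, b}. \<exists>y'\<in>J. f x' y' = f x y"
    if x: "a \<le> x" "x \<le> b" and ab: "a \<in> {0..1}" "b \<in> {0..1}" and pq: "q - p \<ge> 2 * (b - a)" for a b
  proof -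
    have y01: "y \<in> {0..1}" "p \<in> {0..1}" "q \<in> {0..1}" using J by auto
    have mono: "f s y \<le> f t y" if "s \<le> t" for s t
    proof -
      have "f t y - f s y = (B + C * y) * (t - s)" by (simp add: f algebra_simps)
      moreover have "0 \<le> (B + C * y) * (t - s)" using BC y01 that by (intro mult_nonneg_nonneg add_nonneg_nonneg) auto
      ultimately show ?thesis by linarith
    qed
    have "f a q - f b p = (B + C * a) * (q - p) - (B + C * p) * (b - a)"
      by (simp add: f algebra_simps)
    moreover have "B * (2 * (b - a)) \<le> (B + C * a) * (q - p)"
      using BC ab pq x by (intro mult_mono) auto
    moreover have "(B + C * p) * (b - a) \<le> (2 * B) * (b - a)"
    proof (intro mult_right_mono)
      have "C * p \<le> B * 1" using BC y01 by (intro mult_mono) auto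
      then show "B + C * p \<le> 2 * B" by simp
    qed (use x in auto)
    ultimately have pq': "f b p \<le> f a q" by (simp add: algebra_simps)
    show ?thesis
    proof (cases "f x y \<le> f a q")
      case True
      then show ?thesis using ivt[of y q a "f x y"] mono[OF x(1)] J by blast
    next
      case False
      then show ?thesis using ivt[of p y b "f x y"] mono[OF x(2)] J pq' by fastforce
    qed
  qed
  show ?thesis
  proof (cases "a \<le> b")
    case True
    then show ?thesis using x J * [of a b] by (auto simp: closed_segment_eq_real_ivl)
  next
    case False
    then show ?thesis using x J * [of b a] by (auto simp: closed_segment_eq_real_ivl)
  qed
qed

context thick_digits
begin

lemma spans_bound:
  assumes "valid (w, i, j)" "spans (piece_set (w, i, j)) r"
  shows "r * length w \<le> 1"
proof -
  obtain p q where pq: "p \<in> piece_set (w, i, j)" "q \<in> piece_set (w, i, j)" "r \<le> q - p"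
    using assms(2) by (auto simp: spans_def)
  then obtain x y where xy: "x \<in> {0..1}" "y \<in> {0..1}" "p = cf_map w x" "q = cf_map w y"
    using piece_param[OF assms(1)] unfolding piece_set_def by (auto simp del: atLeastAtMost_iff)
  have "r * length w \<le> \<bar>q - p\<bar> * length w" using pq by (intro mult_right_mono) auto
  also have "\<dots> \<le> 1" using cf_map_diff_le[OF valid_zero[OF assms(1)] xy(2,1)] by (simp add: xy)
  finally show ?thesis .
qed

lemma gap_lower:
  assumes "valid (w, i, j)" "length w \<le> L"
  shows "gap (w, i, j) \<ge> (1 - (\<beta> - \<alpha>)) / (K * (2 * real (K + 1) ^ L))\<^sup>2"
proof -
  have w: "0 \<notin> set w" "\<forall>d\<in>set w. d \<le> K" and ij: "1 \<le> i" "i \<le> K"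
    using assms by (auto simp: valid_def)
  have q: "den w 0 \<ge> 1" using w den_ge_1 by simp
  have "den w 0 \<le> 2 * real (K + 1) ^ length w" by (intro den_le_power w)
  also have "\<dots> \<le> 2 * real (K + 1) ^ L" using assms(2) by (intro mult_left_mono power_increasing) auto
  finally have "i * den w 0 \<le> K * (2 * real (K + 1) ^ L)" using ij q by (intro mult_mono) auto
  moreover have "0 < i * den w 0" using ij q by auto
  ultimately show ?thesis
    unfolding gap_def prod.case using \<beta>_less_1 \<alpha>_pos K_ge_2
    by (intro divide_left_mono power_mono mult_pos_pos[OF zero_less_power zero_less_power])
      (assumption | simp)+
qed

text \<open>A refining sequence of pairs cannot refine only one side.  If the words of \<open>d n\<close> stayed short,
  then the depth would force the words of \<open>c n\<close> to become long and the pieces \<open>c n\<close> to become small, while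
  the gaps of \<open>d n\<close>, which they have to span, would stay bounded away from \<open>0\<close>.\<close>
lemma both_lengths_unbounded:
  assumes c: "\<And>n. valid (c n)" and d: "\<And>n. valid (d n)"
    and span: "\<And>n. spans (piece_set (c n)) (2 * gap (d n))"
    and depth: "\<And>n. n \<le> depth (c n) + depth (d n)"
  shows "\<exists>n. L \<le> length (fst (d n))"
proof (rule ccontr)
  assume "\<nexists>n. L \<le> length (fst (d n))"
  then have short: "length (fst (d n)) \<le> L" for n by (meson nat_le_linear)
  define \<eta> where "\<eta> = (1 - (\<beta> - \<alpha>)) / (K * (2 * real (K + 1) ^ L))\<^sup>2"
  have \<eta>: "\<eta> > 0" unfolding \<eta>_def using \<beta>_less_1 \<alpha>_pos K_ge_2 by (intro divide_pos_pos zero_less_power) auto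
  obtain M :: nat where M: "1 / \<eta> < M" using reals_Archimedean2 by blast
  define n where "n = (M + 1) * K + (L + 1) * K"
  have depth_le: "depth e \<le> (length (fst e) + 1) * K" if "valid e" for e
    using that by (cases e) (auto simp: depth_def valid_def)
  have "depth (d n) \<le> (L + 1) * K"
    using depth_le[OF d[of n]] short[of n] by (meson add_le_mono1 le_trans mult_le_mono1)
  then have "(M + 1) * K \<le> (length (fst (c n)) + 1) * K"
    using depth_le[OF c[of n]] depth[of n] unfolding n_def by linarith
  then have len: "M \<le> length (fst (c n))" using K_ge_2 by simp
  obtain w i j where e: "c n = (w, i, j)" by (cases "c n")
  obtain w' i' j' where e': "d n = (w', i', j')" by (cases "d n")
  have "\<eta> \<le> gap (d n)"
    unfolding \<eta>_def e' using d[of n] short[of n] by (intro gap_lower) (auto simp: e')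
  then have "spans (piece_set (w, i, j)) \<eta>"
    using span[of n] gap_nonneg[of "d n"] by (auto simp: e intro: spans_mono)
  then have "\<eta> * length w \<le> 1" using spans_bound c[of n] by (simp add: e)
  moreover have "1 < \<eta> * M" using M \<eta> by (simp add: field_simps)
  moreover have "\<eta> * M \<le> \<eta> * length w" using len \<eta> by (intro mult_left_mono) (auto simp: e)
  ultimately show False by linarith
qed

lemma extends_trans: "extends a b \<Longrightarrow> extends b c \<Longrightarrow> extends a c"
  by (auto simp: extends_def)

lemma nested_pieces_limit:
  assumes c: "\<And>n. valid (c n)" and ext: "\<And>n. extends (c n) (c (Suc n))"
    and unbounded: "\<And>L. \<exists>n. L \<le> length (fst (c n))"
    and x: "\<And>n. x n \<in> piece_set (c n)"
  obtains \<sigma> where "\<And>i. \<sigma> i \<in> {1..K}" "x \<longlonglongrightarrow> cf_val \<sigma>"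
proof -
  define w where "w = (\<lambda>n. fst (c n))"
  have ext': "extends (c m) (c n)" if "m \<le> n" for m n
    using that
  proof (induction n rule: dec_induct)
    case base
    show ?case by (simp add: extends_def)
  next
    case (step n)
    then show ?case using ext extends_trans by blast
  qed
  have nth: "w n ! i = w m ! i" if "i < length (w m)" "m \<le> n" for i m n
    using ext'[OF that(2)] that(1) by (auto simp: extends_def w_def nth_append)
  have len: "length (w m) \<le> length (w n)" if "m \<le> n" for m n
    using ext'[OF that] by (auto simp: extends_def w_def)
  define N where "N = (\<lambda>i. SOME n. i < length (w n))"
  have N: "i < length (w (N i))" for i
  proof -
    have "\<exists>n. i < length (w n)" using unbounded[of "Suc i"] by (auto simp: w_def Suc_le_eq)
    then show ?thesis unfolding N_def by (rule someI_ex)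
  qed
  define \<sigma> where "\<sigma> = (\<lambda>i. w (N i) ! i)"
  have \<sigma>_nth: "w n ! i = \<sigma> i" if "i < length (w n)" for n i
    using nth[OF that, of "max n (N i)"] nth[OF N[of i], of "max n (N i)"] by (simp add: \<sigma>_def)
  have w: "set (w n) \<subseteq> {1..K}" for n using c[of n] by (cases "c n") (auto simp: w_def valid_def)
  have digits: "\<sigma> i \<in> {1..K}" for i
    unfolding \<sigma>_def using w N nth_mem by blast
  have prefix: "map \<sigma> [0..<length (w n)] = w n" for n
    by (rule nth_equalityI) (auto simp: \<sigma>_nth)
  have near: "\<bar>x n - cf_val \<sigma>\<bar> * length (w n) \<le> 1" for n
  proof -
    obtain v i j where e: "c n = (v, i, j)" by (cases "c n")
    then have v: "v = w n" by (simp add: w_def)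
    obtain z where z: "z \<in> {0..1}" "x n = cf_map v z"
      using x[of n] piece_param[of v i j] c[of n] unfolding e piece_set_def
      by (auto simp del: atLeastAtMost_iff)
    have "\<bar>cf_map (map \<sigma> [0..<length (w n)]) z - cf_val \<sigma>\<bar> * length (w n) \<le> 1"
      using digits by (intro cf_val_near z) auto
    then show ?thesis by (simp add: prefix z v)
  qed
  have "x \<longlonglongrightarrow> cf_val \<sigma>"
  proof (rule LIMSEQ_I)
    fix r :: real assume r: "r > 0"
    obtain L :: nat where L: "1 / r < L" using reals_Archimedean2 by blast
    obtain m where m: "L \<le> length (w m)" using unbounded by (auto simp: w_def)
    have "norm (x n - cf_val \<sigma>) < r" if "n \<ge> m" for n
    proof (rule ccontr)
      assume "\<not> norm (x n - cf_val \<sigma>) < r"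
      then have "r * L \<le> \<bar>x n - cf_val \<sigma>\<bar> * length (w n)"
        using m len[OF that] r by (intro mult_mono) auto
      moreover have "1 < r * L" using L r by (simp add: field_simps)
      ultimately show False using near[of n] by linarith
    qed
    then show "\<exists>no. \<forall>n\<ge>no. norm (x n - cf_val \<sigma>) < r" by blast
  qed
  with digits that show ?thesis by blast
qed

text \<open>The invariant of the construction: the pair of pieces still contains a solution of \<open>f x y = v\<close>,
  and each piece is long enough to bridge the next gap of the other one.\<close>
definition linked :: "(real \<Rightarrow> real \<Rightarrow> real) \<Rightarrow> real \<Rightarrow> piece \<Rightarrow> piece \<Rightarrow> bool" where
  "linked f v c d \<longleftrightarrow> valid c \<and> valid d
     \<and> spans (piece_set c) (2 * gap d) \<and> spans (piece_set d) (2 * gap c)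
     \<and> (\<exists>x\<in>piece_set c. \<exists>y\<in>piece_set d. f x y = v)"

text \<open>The piece with the larger gap is refined.  Its parts span twice that gap, hence also twice the gap
  of the other piece, and the other piece keeps spanning because gaps only decrease.\<close>
lemma linked_refine_left:
  assumes f: "f = (\<lambda>s t. A + B * (s + t) + C * s * t)" and BC: "0 \<le> C" "C \<le> B"
    and l: "linked f v c d" and le: "gap d \<le> gap c"
  shows "\<exists>c'. linked f v c' d \<and> extends c c' \<and> depth c < depth c'"
proof -
  have v: "valid c" "valid d" using l by (auto simp: linked_def)
  obtain c\<^sub>1 c\<^sub>2 where
    e: "\<And>e. e \<in> {c\<^sub>1, c\<^sub>2} \<Longrightarrow> valid e \<and> extends c e \<and> gap e \<le> gap c \<and> depth c < depth e
        \<and> spans (piece_set e) (2 * gap c)" and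
    seg: "\<And>x. x \<in> piece_set c \<Longrightarrow> \<exists>a b. a \<in> piece_set c\<^sub>1 \<union> piece_set c\<^sub>2 \<and> b \<in> piece_set c\<^sub>1 \<union> piece_set c\<^sub>2
        \<and> x \<in> closed_segment a b \<and> \<bar>a - b\<bar> \<le> gap c"
    using split_piece[OF v(1)] by blast
  obtain x y where xy: "x \<in> piece_set c" "y \<in> piece_set d" "f x y = v"
    using l by (auto simp: linked_def)
  obtain a b where ab: "a \<in> piece_set c\<^sub>1 \<union> piece_set c\<^sub>2" "b \<in> piece_set c\<^sub>1 \<union> piece_set c\<^sub>2"
    "x \<in> closed_segment a b" "\<bar>a - b\<bar> \<le> gap c" using seg[OF xy(1)] by blast
  obtain p q where pq: "p \<in> piece_set d" "q \<in> piece_set d" "q - p \<ge> 2 * gap c"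
    using l by (auto simp: linked_def spans_def)
  have ab01: "a \<in> {0..1}" "b \<in> {0..1}" using ab(1,2) piece_subset e by blast+
  have pq': "q - p \<ge> 2 * \<bar>a - b\<bar>" using mult_left_mono[OF ab(4), of 2] pq(3) by simp
  from interval_cover[OF f BC ab(3) ab01 connected_piece[OF v(2)] piece_subset[OF v(2)] xy(2) pq(1,2) pq']
  obtain x' y' where x': "x' \<in> {a, b}" "y' \<in> piece_set d" "f x' y' = v" using xy(3) by blast
  then obtain c' where c': "c' \<in> {c\<^sub>1, c\<^sub>2}" "x' \<in> piece_set c'" using ab by blast
  have "linked f v c' d"
    unfolding linked_def
  proof (intro conjI)
    show "spans (piece_set c') (2 * gap d)" using e[OF c'(1)] le by (auto intro: spans_mono)
    show "spans (piece_set d) (2 * gap c')"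
      using e[OF c'(1)] l by (auto simp: linked_def intro: spans_mono)
  qed (use e[OF c'(1)] v c' x' in auto)
  then show ?thesis using e[OF c'(1)] by blast
qed

lemma linked_sym: "(\<And>s t. f s t = f t s) \<Longrightarrow> linked f v c d \<Longrightarrow> linked f v d c"
  unfolding linked_def by metis

lemma linked_refine:
  assumes f: "f = (\<lambda>s t. A + B * (s + t) + C * s * t)" and BC: "0 \<le> C" "C \<le> B"
    and l: "linked f v c d"
  shows "\<exists>c' d'. linked f v c' d' \<and> extends c c' \<and> extends d d' \<and> depth c + depth d < depth c' + depth d'"
proof -
  have refl: "extends e e" for e by (simp add: extends_def)
  have sym: "f s t = f t s" for s t by (simp add: f algebra_simps)
  show ?thesis
  proof (cases "gap d \<le> gap c")
    case True
    then show ?thesis using linked_refine_left[OF f BC l] refl by (meson add_less_mono1)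
  next
    case False
    then obtain d' where "linked f v d' c" "extends d d'" "depth d < depth d'"
      using linked_refine_left[OF f BC linked_sym[OF sym l]] by auto
    then show ?thesis using linked_sym[OF sym] refl by (meson add_less_cancel_left)
  qed
qed

text \<open>A theorem in the style of Hall and Newhouse: a symmetric bilinear function of two elements of a
  thick Cantor set takes all values between its extreme ones.  Refining linked pairs forever
  determines all digits of the two elements.\<close>
theorem cf_values_cover:
  assumes BC: "0 \<le> C" "C \<le> B"
    and v: "A + 2 * B * \<alpha> + C * \<alpha> * \<alpha> \<le> v" "v \<le> A + 2 * B * \<beta> + C * \<beta> * \<beta>"
  obtains \<sigma> \<tau> where "\<And>i. \<sigma> i \<in> {1..K}" "\<And>i. \<tau> i \<in> {1..K}"
    "A + B * (cf_val \<sigma> + cf_val \<tau>) + C * cf_val \<sigma> * cf_val \<tau> = v"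
proof -
  define f where "f = (\<lambda>s t. A + B * (s + t) + C * s * t)"
  define r where "r = ([] :: nat list, 1 :: nat, K)"
  have root: "piece_set r = {\<alpha>..\<beta>}"
    by (simp add: piece_set_def r_def \<alpha>_eq[symmetric] \<beta>_eq[symmetric])
  have gap_root: "gap r = 1 - (\<beta> - \<alpha>)" by (simp add: gap_def r_def den_def)
  have "spans (piece_set r) (2 * gap r)"
    using thick \<alpha>_less_\<beta> unfolding spans_def root gap_root
    by (intro bexI[of _ \<alpha>] bexI[of _ \<beta>]) (auto simp: algebra_simps)
  moreover have "\<exists>x\<in>piece_set r. f x x = v"
  proof -
    have "continuous_on {\<alpha>..\<beta>} (\<lambda>x. f x x)" unfolding f_def by (intro continuous_intros)
    moreover have "f \<alpha> \<alpha> \<le> v" "v \<le> f \<beta> \<beta>" using v by (simp_all add: f_def)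
    ultimately show ?thesis
      using IVT'[of "\<lambda>x. f x x" \<alpha> v \<beta>] \<alpha>_less_\<beta> by (auto simp: root)
  qed
  ultimately have start: "linked f v r r"
    using K_ge_2 by (auto simp: linked_def valid_def r_def)
  have "\<exists>st. \<forall>n. (linked f v (fst (st n)) (snd (st n)) \<and> n \<le> depth (fst (st n)) + depth (snd (st n)))
      \<and> (extends (fst (st n)) (fst (st (Suc n))) \<and> extends (snd (st n)) (snd (st (Suc n))))"
  proof (rule dependent_nat_choice)
    show "\<exists>s. linked f v (fst s) (snd s) \<and> 0 \<le> depth (fst s) + depth (snd s)"
      using start by (intro exI[of _ "(r, r)"]) simp
  next
    fix s n assume s: "linked f v (fst s) (snd s) \<and> n \<le> depth (fst s) + depth (snd s)"
    then obtain c' d' where "linked f v c' d'" "extends (fst s) c'" "extends (snd s) d'"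
      "depth (fst s) + depth (snd s) < depth c' + depth d'"
      using linked_refine[OF f_def BC] by blast
    then show "\<exists>s'. (linked f v (fst s') (snd s') \<and> Suc n \<le> depth (fst s') + depth (snd s'))
        \<and> extends (fst s) (fst s') \<and> extends (snd s) (snd s')"
      using s by (intro exI[of _ "(c', d')"]) auto
  qed
  then obtain st where st: "\<And>n. linked f v (fst (st n)) (snd (st n))"
      "\<And>n. n \<le> depth (fst (st n)) + depth (snd (st n))"
      "\<And>n. extends (fst (st n)) (fst (st (Suc n)))" "\<And>n. extends (snd (st n)) (snd (st (Suc n)))"
    by blast
  have "\<forall>n. \<exists>x y. x \<in> piece_set (fst (st n)) \<and> y \<in> piece_set (snd (st n)) \<and> f x y = v"
    using st(1) unfolding linked_def by blast
  then obtain x y where xy: "\<And>n. x n \<in> piece_set (fst (st n))" "\<And>n. y n \<in> piece_set (snd (st n))"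
      "\<And>n. f (x n) (y n) = v" by metis
  have valid: "valid (fst (st n))" "valid (snd (st n))" for n using st(1) by (auto simp: linked_def)
  have "\<exists>n. L \<le> length (fst (fst (st n)))" for L
    using st(1,2) by (intro both_lengths_unbounded[of "\<lambda>n. snd (st n)"]) (auto simp: linked_def add_ac)
  then obtain \<sigma> where \<sigma>: "\<And>i. \<sigma> i \<in> {1..K}" "x \<longlonglongrightarrow> cf_val \<sigma>"
    using nested_pieces_limit[of "\<lambda>n. fst (st n)" x] valid(1) st(3) xy(1) by blast
  have "\<exists>n. L \<le> length (fst (snd (st n)))" for L
    using st(1,2) by (intro both_lengths_unbounded[of "\<lambda>n. fst (st n)"]) (auto simp: linked_def)
  then obtain \<tau> where \<tau>: "\<And>i. \<tau> i \<in> {1..K}" "y \<longlonglongrightarrow> cf_val \<tau>"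
    using nested_pieces_limit[of "\<lambda>n. snd (st n)" y] valid(2) st(4) xy(2) by blast
  have "(\<lambda>n. f (x n) (y n)) \<longlonglongrightarrow> f (cf_val \<sigma>) (cf_val \<tau>)"
    unfolding f_def by (intro tendsto_intros \<sigma>(2) \<tau>(2))
  then have "f (cf_val \<sigma>) (cf_val \<tau>) = v" using xy(3) by (simp add: LIMSEQ_const_iff)
  with that \<sigma>(1) \<tau>(1) show ?thesis unfolding f_def by blast
qed

end

section \<open>Denominators and approximation errors\<close>

lemma LIMSEQ_of_weighted_bound:
  fixes x :: "nat \<Rightarrow> real"
  assumes "\<And>n. \<bar>x n - l\<bar> * n \<le> 1"
  shows "x \<longlonglongrightarrow> l"
proof (rule Lim_null[THEN iffD2], rule Lim_null_comparison)
  show "\<forall>\<^sub>F n in sequentially. norm (x n - l) \<le> 1 / n"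
    using eventually_gt_at_top[of 0]
  proof eventually_elim
    case (elim n)
    then show ?case using assms[of n] by (simp add: pos_le_divide_eq)
  qed
  show "(\<lambda>n. 1 / real n) \<longlonglongrightarrow> 0" by (rule lim_1_over_n)
qed

text \<open>The sequence \<open>b\<close> lists the partial quotients \<open>a\<^sub>1, a\<^sub>2, \<dots>\<close>, so \<open>b k\<close> is \<open>a\<^sub>k\<^sub>+\<^sub>1\<close>.\<close>
locale digit_seq =
  fixes b :: "nat \<Rightarrow> nat"
  assumes b_ge_1: "\<And>i. b i \<ge> 1"
begin

definition tail :: "nat \<Rightarrow> real" where
  "tail k = cf_val (\<lambda>i. b (k + i))"

definition q :: "nat \<Rightarrow> real" where
  "q k = of_int (cf_denom (cf_val b) k)"

text \<open>For \<open>k \<ge> 1\<close> this product turns out to be the distance of \<open>q k * cf_val b\<close> from the integers.\<close>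
definition err :: "nat \<Rightarrow> real" where
  "err k = (\<Prod>i\<le>k. tail i)"

text \<open>The continued fraction of the digits before position \<open>k\<close>, read backwards.  At \<open>k = 0\<close> there is no
  digit, and the value \<open>0\<close> corresponds to \<open>q\<^sub>-\<^sub>1 = 0\<close>.\<close>
definition ratio :: "nat \<Rightarrow> real" where
  "ratio k = (if k = 0 then 0 else q (k - 1) / q k)"

text \<open>For \<open>L \<ge> 1\<close> this is the reciprocal of \<open>q j * err (j + L - 1)\<close>, see \<open>q_err_window\<close>; it shows how that product
  depends on the digits.\<close>
definition window :: "nat \<Rightarrow> nat \<Rightarrow> real" where
  "window j L = cform (map b [j..<j + L]) 1 (ratio j) 1 (tail (j + L))"

lemma tail_pos: "0 < tail k" and tail_less_1: "tail k < 1"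
  unfolding tail_def by (rule cf_val_in_open, rule b_ge_1)+

lemma tail_rec: "tail k * (b k + tail (Suc k)) = 1"
proof -
  have "tail k = 1 / (real (b (k + 0)) + cf_val (\<lambda>i. b (k + Suc i)))"
    unfolding tail_def by (rule cf_val_unfold) (rule b_ge_1)
  then have "tail k = 1 / (b k + tail (Suc k))" by (simp add: tail_def)
  moreover have "b k + tail (Suc k) \<noteq> 0" using tail_pos[of "Suc k"] by (metis add_nonneg_pos less_irrefl of_nat_0_le_iff)
  ultimately show ?thesis by simp
qed

lemma cf_val_eq_tail: "cf_val b = tail 0"
  by (simp add: tail_def)

lemma cf_tail_Suc: "cf_tail (cf_val b) (Suc k) = b k + tail (Suc k)"
proof -
  have inv: "1 / tail k = b k + tail (Suc k)" for k
    using tail_rec[of k] tail_pos[of k] by (simp add: field_simps)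
  have frac: "frac (of_nat n + tail k) = tail k" for n k
    using tail_pos[of k] tail_less_1[of k] by (simp add: frac_unique_iff)
  show ?thesis
  proof (induction k)
    case 0
    show ?case using inv[of 0] frac[of 0 0] by (simp add: cf_val_eq_tail)
  next
    case (Suc k)
    then show ?case using inv[of "Suc k"] frac[of "b k" "Suc k"] by simp
  qed
qed

lemma cf_coeff_Suc: "cf_coeff (cf_val b) (Suc k) = int (b k)"
proof -
  have "\<lfloor>of_int (int (b k)) + tail (Suc k)\<rfloor> = int (b k)"
    using tail_pos[of "Suc k"] tail_less_1[of "Suc k"] by (intro floor_unique) auto
  then show ?thesis unfolding cf_coeff_def cf_tail_Suc by simp
qed

lemma q_0: "q 0 = 1" and q_1: "q (Suc 0) = b 0"
  and q_rec: "q (Suc (Suc k)) = b (Suc k) * q (Suc k) + q k"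
  using cf_denom_eq_cf_q[OF cf_val_irrational[of b, OF b_ge_1]]
  by (simp_all add: q_def cf_coeff_Suc)

lemma q_ge_1: "q k \<ge> 1"
proof -
  have "q k \<ge> 1 \<and> q (Suc k) \<ge> 1"
  proof (induction k)
    case 0
    show ?case using b_ge_1[of 0] by (simp add: q_0 q_1)
  next
    case (Suc k)
    have "0 \<le> b (Suc k) * q (Suc k)" using Suc by (intro mult_nonneg_nonneg) auto
    then have "q (Suc (Suc k)) \<ge> 1" unfolding q_rec using Suc by linarith
    with Suc show ?case by blast
  qed
  then show ?thesis by blast
qed

lemma q_Suc_ge_2:
  assumes "k \<ge> 1"
  shows "q (Suc k) \<ge> 2"
proof -
  obtain l where l: "k = Suc l" using assms by (cases k) auto
  have "1 * 1 \<le> b (Suc l) * q (Suc l)"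
    using b_ge_1[of "Suc l"] q_ge_1 by (intro mult_mono) auto
  then show ?thesis using q_ge_1[of l] by (simp add: l q_rec)
qed

lemma err_0: "err 0 = tail 0" and err_Suc: "err (Suc k) = err k * tail (Suc k)"
  by (simp_all add: err_def)

lemma err_pos: "err k > 0"
  unfolding err_def using tail_pos by (intro prod_pos) auto

lemma err_rec: "err k = b (Suc k) * err (Suc k) + err (Suc (Suc k))"
proof -
  have "err k = err k * (tail (Suc k) * (b (Suc k) + tail (Suc (Suc k))))"
    by (simp only: tail_rec mult_1_right)
  then show ?thesis by (simp add: err_Suc algebra_simps)
qed

lemma q_err: "q (Suc k) * err k + q k * err (Suc k) = 1"
proof (induction k)
  case 0
  show ?case using tail_rec[of 0] by (simp add: q_0 q_1 err_0 err_Suc algebra_simps)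
next
  case (Suc k)
  then show ?case unfolding q_rec using err_rec[of k] by (simp add: algebra_simps)
qed

lemma err_in_Ints: "q k * cf_val b - (- 1) ^ k * err k \<in> \<int>"
proof -
  let ?z = "\<lambda>k. q k * cf_val b - (- 1) ^ k * err k"
  have "?z k \<in> \<int> \<and> ?z (Suc k) \<in> \<int>"
  proof (induction k)
    case 0
    have "?z 0 = 0" by (simp add: q_0 err_0 cf_val_eq_tail)
    moreover have "?z (Suc 0) = 1"
      using tail_rec[of 0] by (simp add: q_1 err_0 err_Suc cf_val_eq_tail algebra_simps)
    ultimately show ?case by auto
  next
    case (Suc k)
    have "?z (Suc (Suc k)) = b (Suc k) * ?z (Suc k) + ?z k"
      using err_rec[of k] by (simp add: q_rec algebra_simps)
    then show ?case using Suc by (auto intro!: Ints_add Ints_mult)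
  qed
  then show ?thesis by blast
qed

text \<open>Since \<open>q (Suc k) * err k\<close> is at most \<open>1\<close> and \<open>q (Suc k)\<close> is at least \<open>2\<close>, the integer at distance \<open>err k\<close> is the
  nearest one.  For \<open>k = 0\<close> and first digit \<open>1\<close> this fails.\<close>
lemma dist_Z_q:
  assumes "k \<ge> 1"
  shows "dist_Z (q k * cf_val b) = err k"
proof -
  let ?x = "q k * cf_val b"
  let ?z = "?x - (- 1) ^ k * err k"
  have "0 \<le> q k * err (Suc k)" using q_ge_1[of k] err_pos[of "Suc k"] by auto
  then have "q (Suc k) * err k \<le> 1" using q_err[of k] by linarith
  moreover have "2 * err k \<le> q (Suc k) * err k"
    using q_Suc_ge_2[OF assms] err_pos[of k] by (intro mult_right_mono) auto
  ultimately have small: "err k \<le> 1 / 2" by linarith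
  have dz: "dist ?x ?z = err k"
    using err_pos[of k] by (simp add: dist_real_def abs_mult)
  have "infdist ?x \<int> = err k"
  proof (rule antisym)
    show "infdist ?x \<int> \<le> err k" using infdist_le[OF err_in_Ints[of k], of ?x] dz by simp
    have "err k \<le> dist ?x n" if n: "n \<in> \<int>" for n
    proof (cases "n = ?z")
      case True
      then show ?thesis using dz by simp
    next
      case False
      then have "1 \<le> \<bar>n - ?z\<bar>"
        using Ints_nonzero_abs_ge1[of "n - ?z"] n err_in_Ints[of k] by auto
      also have "\<dots> \<le> dist ?x n + dist ?x ?z" by (simp add: dist_real_def)
      finally show ?thesis using dz small by linarith
    qed
    moreover have "(\<int> :: real set) \<noteq> {}" by auto
    ultimately show "err k \<le> infdist ?x \<int>"
      unfolding infdist_def by (auto intro!: cINF_greatest)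
  qed
  then show ?thesis by (simp add: dist_Z_def)
qed

lemma approx_seq_eq:
  assumes "k \<ge> 1"
  shows "approx_seq m (cf_val b) k = q (nat (int k + m)) * err k"
  using dist_Z_q[OF assms] by (simp add: approx_seq_def q_def)

lemma ratio_Suc: "ratio (Suc k) = 1 / (b k + ratio k)"
proof (cases k)
  case 0
  then show ?thesis by (simp add: ratio_def q_0 q_1)
next
  case (Suc l)
  have "q (Suc l) > 0" using q_ge_1[of "Suc l"] by simp
  then have "b (Suc l) + q l / q (Suc l) = q (Suc (Suc l)) / q (Suc l)"
    by (simp add: q_rec field_simps)
  then show ?thesis by (simp add: Suc ratio_def)
qed

lemma ratio_range: "ratio k \<in> {0..1}"
proof (induction k)
  case (Suc k)
  have "real (b k) \<ge> 1" using b_ge_1[of k] by simp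
  with Suc show ?case by (auto simp: ratio_Suc divide_simps)
qed (simp add: ratio_def)

lemma cform_denominators:
  "cform (map b [j..<Suc (j + n)]) 1 (ratio j) u v * q j = q (Suc (j + n)) * u + q (j + n) * v"
proof (induction n arbitrary: u v)
  case 0
  have "q j > 0" using q_ge_1[of j] by simp
  moreover have "ratio (Suc j) * (b j + ratio j) = 1"
  proof -
    have "b j + ratio j > 0" using b_ge_1[of j] ratio_range[of j] by (auto simp: add_pos_nonneg)
    then show ?thesis by (simp add: ratio_Suc)
  qed
  ultimately have "(b j + ratio j) * q j = q (Suc j)"
    using q_ge_1[of "Suc j"] by (simp add: ratio_def field_simps)
  then have "u * ((b j + ratio j) * q j) = u * q (Suc j)" by simp
  then show ?case by (simp add: algebra_simps)
next
  case (Suc n)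
  have "map b [j..<Suc (j + Suc n)] = map b [j..<Suc (j + n)] @ [b (Suc (j + n))]" by simp
  then show ?case using Suc by (simp only: cform_snoc) (simp add: q_rec algebra_simps)
qed

text \<open>The reason for introducing windows: \<open>window j (Suc n)\<close> equals
  \<open>(q (j + n + 1) + q (j + n) * tail (j + n + 1)) / q j\<close>, whose numerator is \<open>1 / err (j + n)\<close> by \<open>q_err\<close>.\<close>
lemma q_err_window: "q j * err (j + n) * window j (Suc n) = 1"
proof -
  have "window j (Suc n) * q j = q (Suc (j + n)) + q (j + n) * tail (Suc (j + n))"
    unfolding window_def using cform_denominators[of j n 1 "tail (Suc (j + n))"] by simp
  moreover have "q j * err (j + n) * window j (Suc n) = err (j + n) * (window j (Suc n) * q j)" by simp
  ultimately have "q j * err (j + n) * window j (Suc n) = q (Suc (j + n)) * err (j + n) + q (j + n) * err (Suc (j + n))"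
    by (simp only: err_Suc) (simp add: algebra_simps)
  then show ?thesis by (simp only: q_err)
qed

lemma zero_notin_digits: "0 \<notin> set (map b xs)"
proof
  assume "0 \<in> set (map b xs)"
  then obtain i where "b i = 0" by auto
  with b_ge_1[of i] show False by simp
qed

lemma window_ge_1: "window j L \<ge> 1"
proof -
  have "1 \<le> (\<Prod>d\<leftarrow>map b [j..<j + L]. real d)"
    by (intro prod_list_ge_1 zero_notin_digits)
  then show ?thesis
    unfolding window_def using cform_ge_prod[of 1 "ratio j" "tail (j + L)" "map b [j..<j + L]"]
      ratio_range[of j] tail_pos[of "j + L"] by simp
qed

lemma approx_seq_nonpos:
  assumes "j \<ge> 1"
  shows "approx_seq (- int n) (cf_val b) (j + n) = 1 / window j (Suc n)"
proof -
  have "q j * err (j + n) = 1 / window j (Suc n)"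
    using q_err_window[of j n] window_ge_1[of j "Suc n"] by (simp add: field_simps)
  then show ?thesis using assms by (simp add: approx_seq_eq)
qed

text \<open>Both \<open>q (k + m)\<close> and \<open>(- 1) ^ m * err (k + m)\<close> satisfy the recurrence of the denominators in \<open>m\<close>, hence so
  does their cross difference \<open>A m\<close>; its initial values \<open>0\<close> and \<open>1\<close> identify it as a continuant.  A positive
  shift is thereby reduced to a negative one.\<close>
lemma approx_seq_pos:
  assumes "k \<ge> 1"
  shows "approx_seq (int (Suc n)) (cf_val b) k
    = cform (map b [Suc k..<Suc k + n]) 1 0 1 0 - (- 1) ^ n / window k (Suc (Suc n))"
proof -
  define A where "A = (\<lambda>m. q (k + m) * err k - (- 1) ^ m * q k * err (k + m))"
  have A0: "A 0 = 0" by (simp add: A_def)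
  have A1: "A (Suc 0) = 1" using q_err[of k] by (simp add: A_def)
  have A_rec: "A (Suc (Suc m)) = b (Suc (k + m)) * A (Suc m) + A m" for m
    using err_rec[of "k + m"] by (simp add: A_def q_rec algebra_simps)
  have "cform (map b [Suc k..<Suc k + m]) 1 0 u v = A (Suc m) * u + A m * v" for m u v
  proof (induction m arbitrary: u v)
    case 0
    show ?case by (simp add: A0 A1)
  next
    case (Suc m)
    have "map b [Suc k..<Suc k + Suc m] = map b [Suc k..<Suc k + m] @ [b (Suc (k + m))]" by simp
    then show ?case using Suc by (simp only: cform_snoc) (simp add: A_rec algebra_simps)
  qed
  from this[of n 1 0] have "cform (map b [Suc k..<Suc k + n]) 1 0 1 0 = A (Suc n)" by simp
  moreover have "q k * err (k + Suc n) = 1 / window k (Suc (Suc n))"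
    using q_err_window[of k "Suc n"] window_ge_1[of k "Suc (Suc n)"] by (simp add: field_simps)
  then have "A (Suc n) = q (k + Suc n) * err k + (- 1) ^ n / window k (Suc (Suc n))"
    by (simp add: A_def mult.assoc)
  moreover have "approx_seq (int (Suc n)) (cf_val b) k = q (k + Suc n) * err k"
    using assms by (simp add: approx_seq_eq nat_add_distrib flip: of_nat_add)
  ultimately show ?thesis by simp
qed

lemma ratio_prefix:
  assumes "n \<le> r"
  shows "ratio r = cf_map (map (\<lambda>i. b (r - 1 - i)) [0..<n]) (ratio (r - n))"
  using assms
proof (induction n)
  case (Suc n)
  then have "ratio (r - n) = 1 / (b (r - 1 - n) + ratio (r - Suc n))"
    using ratio_Suc[of "r - Suc n"] by (simp add: Suc_diff_Suc)
  with Suc show ?case by (simp add: cf_map_append)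
qed simp

lemma ratio_LIMSEQ:
  assumes "\<And>i. \<tau> i \<ge> 1" "\<And>j. j \<le> r j" "\<And>i j. i < j \<Longrightarrow> b (r j - 1 - i) = \<tau> i"
  shows "(\<lambda>j. ratio (r j)) \<longlonglongrightarrow> cf_val \<tau>"
proof (rule LIMSEQ_of_weighted_bound)
  fix j
  have past: "map (\<lambda>i. b (r j - 1 - i)) [0..<j] = map \<tau> [0..<j]" using assms(3) by auto
  have "ratio (r j) = cf_map (map \<tau> [0..<j]) (ratio (r j - j))"
    using ratio_prefix[OF assms(2)[of j]] unfolding past .
  then show "\<bar>ratio (r j) - cf_val \<tau>\<bar> * j \<le> 1"
    using cf_val_near[of \<tau>, OF assms(1) ratio_range] by simp
qed

lemma tail_LIMSEQ:
  assumes "\<And>i. \<sigma> i \<ge> 1" "\<And>i j. i < j \<Longrightarrow> b (r j + i) = \<sigma> i"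
  shows "(\<lambda>j. tail (r j)) \<longlonglongrightarrow> cf_val \<sigma>"
proof (rule LIMSEQ_of_weighted_bound)
  fix j
  have future: "map (\<lambda>i. b (r j + i)) [0..<j] = map \<sigma> [0..<j]" using assms(2) by auto
  have "tail (r j) = cf_map (map (\<lambda>i. b (r j + i)) [0..<j]) (cf_val (\<lambda>i. b (r j + (j + i))))"
    unfolding tail_def by (rule cf_val_prefix) (rule b_ge_1)
  moreover have "cf_val (\<lambda>i. b (r j + (j + i))) \<in> {0..1}" by (rule cf_val_range) (rule b_ge_1)
  ultimately show "\<bar>tail (r j) - cf_val \<sigma>\<bar> * j \<le> 1"
    using cf_val_near[of \<sigma>, OF assms(1)] unfolding future by simp
qed

end

section \<open>Digit sequences with spikes\<close>

text \<open>Block number \<open>j\<close> is \<open>W, \<sigma> 0, \<dots>, \<sigma> j, \<tau> j, \<dots>, \<tau> 0\<close>.  It ends with the reversed past of the next spike, so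
  the spikes see longer and longer parts of \<open>\<tau>\<close> on the left and of \<open>\<sigma>\<close> on the right.\<close>
lemma spike_sequence:
  fixes W :: "nat list" and \<sigma> \<tau> :: "nat \<Rightarrow> nat"
  obtains b :: "nat \<Rightarrow> nat" and r :: "nat \<Rightarrow> nat" where
    "strict_mono r" "\<And>j. j \<le> r j"
    "\<And>i j. i < j \<Longrightarrow> b (r j - 1 - i) = \<tau> i"
    "\<And>j d. d < length W \<Longrightarrow> b (r j + d) = W ! d"
    "\<And>i j. i \<le> j \<Longrightarrow> b (r j + length W + i) = \<sigma> i"
    "\<And>i. (\<exists>j d. i = r j + d \<and> d < length W) \<or> b i \<in> range \<sigma> \<union> range \<tau>"
proof -
  define L where "L = length W"
  define r where "r = (\<lambda>j. j * (j + L + 1))"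
  have r_Suc: "r (Suc j) = r j + (2 * j + L + 2)" for j by (simp add: r_def algebra_simps)
  have mono: "strict_mono r" by (simp add: strict_mono_Suc_iff r_Suc)
  have ex: "\<exists>j d. i = r j + d \<and> d < 2 * j + L + 2" for i
  proof (induction i)
    case 0
    show ?case by (intro exI[of _ 0]) (simp add: r_def)
  next
    case (Suc i)
    then obtain j d where jd: "i = r j + d" "d < 2 * j + L + 2" by blast
    show ?case
    proof (cases "Suc d < 2 * j + L + 2")
      case True
      then show ?thesis using jd by (intro exI[of _ j] exI[of _ "Suc d"]) simp
    next
      case False
      then have "Suc i = r (Suc j) + 0" using jd by (simp add: r_Suc)
      then show ?thesis by (intro exI[of _ "Suc j"] exI[of _ 0]) simp
    qed
  qed
  have le: "j' \<le> j" if "r j' + d' = r j + d" "d < 2 * j + L + 2" for j j' d d'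
  proof (rule ccontr)
    assume "\<not> j' \<le> j"
    then have "r (Suc j) \<le> r j'" using mono by (simp add: strict_mono_less_eq)
    then show False using that r_Suc[of j] by linarith
  qed
  have uniq: "j' = j \<and> d' = d" if "r j' + d' = r j + d" "d < 2 * j + L + 2" "d' < 2 * j' + L + 2" for j j' d d'
    using le[OF that(1,2)] le[OF that(1)[symmetric] that(3)] that(1) by auto
  define block where "block = (\<lambda>j d. if d < L then W ! d else if d \<le> L + j then \<sigma> (d - L) else \<tau> (2 * j + L + 1 - d))"
  define b where "b = (\<lambda>i. THE x. \<exists>j d. i = r j + d \<and> d < 2 * j + L + 2 \<and> x = block j d)"
  have b: "b (r j + d) = block j d" if "d < 2 * j + L + 2" for j d
    unfolding b_def
  proof (rule the_equality)
    show "\<exists>j' d'. r j + d = r j' + d' \<and> d' < 2 * j' + L + 2 \<and> block j d = block j' d'" using that by blast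
  next
    fix x assume "\<exists>j' d'. r j + d = r j' + d' \<and> d' < 2 * j' + L + 2 \<and> x = block j' d'"
    then show "x = block j d" using uniq that by metis
  qed
  show ?thesis
  proof (rule that[of r b])
    show "strict_mono r" by (rule mono)
    show "j \<le> r j" for j by (simp add: r_def)
    show "b (r j - 1 - i) = \<tau> i" if "i < j" for i j
    proof -
      obtain l where l: "j = Suc l" using \<open>i < j\<close> by (cases j) auto
      define d where "d = 2 * l + L + 1 - i"
      have d: "\<not> d < L" "\<not> d \<le> L + l" "2 * l + L + 1 - d = i" "d < 2 * l + L + 2"
        using \<open>i < j\<close> by (auto simp: d_def l)
      have "r j - 1 - i = r l + d" using \<open>i < j\<close> by (simp add: l r_Suc d_def)
      then have "b (r j - 1 - i) = block l d" using b[OF d(4)] by simp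
      then show ?thesis using d by (simp add: block_def)
    qed
    show "b (r j + d) = W ! d" if "d < length W" for j d
      using b[of d j] that by (simp add: block_def L_def)
    show "b (r j + length W + i) = \<sigma> i" if "i \<le> j" for i j
      using b[of "L + i" j] that by (simp add: block_def L_def add.assoc)
    show "(\<exists>j d. i = r j + d \<and> d < length W) \<or> b i \<in> range \<sigma> \<union> range \<tau>" for i
    proof -
      obtain j d where jd: "i = r j + d" "d < 2 * j + L + 2" using ex by blast
      show ?thesis
      proof (cases "d < L")
        case True
        then show ?thesis using jd by (auto simp: L_def)
      next
        case False
        then show ?thesis using b[OF jd(2)] by (simp add: jd(1) block_def)
      qed
    qed
  qed
qed

text \<open>The bound on the digit after each copy of \<open>W\<close> keeps the copies apart: a run of huge digits cannot
  extend across the end of a copy.\<close>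
definition spiked :: "nat list \<Rightarrow> nat \<Rightarrow> (nat \<Rightarrow> nat) \<Rightarrow> (nat \<Rightarrow> nat) \<Rightarrow> real \<Rightarrow> bool" where
  "spiked W K b r v \<longleftrightarrow> digit_seq b \<and> strict_mono r
     \<and> (\<lambda>j. digit_seq.window b (r j) (length W)) \<longlonglongrightarrow> v
     \<and> (\<forall>j. \<forall>d<length W. b (r j + d) = W ! d)
     \<and> (\<forall>j. b (r j + length W) \<le> K)
     \<and> (\<forall>i. K < b i \<longrightarrow> (\<exists>j d. i = r j + d \<and> d < length W))"

lemma spiked_exists:
  assumes \<sigma>: "\<And>i. \<sigma> i \<in> {1..K}" and \<tau>: "\<And>i. \<tau> i \<in> {1..K}" and W: "0 \<notin> set W"
  shows "\<exists>b r. spiked W K b r (cform W 1 (cf_val \<tau>) 1 (cf_val \<sigma>))"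
proof -
  obtain b r where br: "strict_mono r" "\<And>j. j \<le> r j"
    "\<And>i j. i < j \<Longrightarrow> b (r j - 1 - i) = \<tau> i"
    "\<And>j d. d < length W \<Longrightarrow> b (r j + d) = W ! d"
    "\<And>i j. i \<le> j \<Longrightarrow> b (r j + length W + i) = \<sigma> i"
    "\<And>i. (\<exists>j d. i = r j + d \<and> d < length W) \<or> b i \<in> range \<sigma> \<union> range \<tau>"
    by (rule spike_sequence[where W = W and \<sigma> = \<sigma> and \<tau> = \<tau>]) (rule that)
  have small: "b i \<in> {1..K}" if "\<nexists>j d. i = r j + d \<and> d < length W" for i
    using br(6)[of i] that \<sigma> \<tau> by (metis Un_iff imageE)
  have "b i \<ge> 1" for i
  proof (cases "\<exists>j d. i = r j + d \<and> d < length W")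
    case True
    then obtain j d where "i = r j + d" "d < length W" by blast
    then have "b i \<in> set W" using br(4) by simp
    then show ?thesis using W by (metis Suc_leI One_nat_def gr0I)
  next
    case False
    then show ?thesis using small by simp
  qed
  then interpret digit_seq b by unfold_locales
  have digits: "\<sigma> i \<ge> 1" "\<tau> i \<ge> 1" for i using \<sigma>[of i] \<tau>[of i] by auto
  have past: "(\<lambda>j. ratio (r j)) \<longlonglongrightarrow> cf_val \<tau>"
    by (rule ratio_LIMSEQ) (use digits br in auto)
  have future: "(\<lambda>j. tail (r j + length W)) \<longlonglongrightarrow> cf_val \<sigma>"
    by (rule tail_LIMSEQ) (use digits br in auto)
  have word: "map b [r j..<r j + length W] = W" for j
    by (rule nth_equalityI) (auto simp: br)
  define A B C D where "A = cform W 1 0 1 0" and "B = cform W 1 0 0 1"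
    and "C = cform W 0 1 1 0" and "D = cform W 0 1 0 1"
  have expand: "cform W 1 s 1 t = A + t * B + s * (C + t * D)" for s t
    using cform_left[of W 1 s 1 t] cform_right[of W 1 0 1 t] cform_right[of W 0 1 1 t]
    by (simp add: A_def B_def C_def D_def)
  have "(\<lambda>j. window (r j) (length W)) \<longlonglongrightarrow> cform W 1 (cf_val \<tau>) 1 (cf_val \<sigma>)"
    unfolding window_def word expand
    by (intro tendsto_intros past future)
  moreover have "b (r j + length W) \<le> K" for j using br(5)[of 0 j] \<sigma>[of 0] by simp
  moreover have "\<exists>j d. i = r j + d \<and> d < length W" if "K < b i" for i
    using small[of i] that by force
  ultimately show ?thesis
    unfolding spiked_def using digit_seq_axioms br(1,4) by blast
qed

text \<open>The equations for \<open>\<alpha>\<close> and \<open>\<beta>\<close> give \<open>\<beta> = K * \<alpha>\<close> and the quadratic equation \<open>K * \<alpha> * (1 + \<alpha>) = 1\<close>.  Then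
  \<open>1 - (\<beta> - \<alpha>)\<close> is below \<open>2 * \<alpha>\<close>, which is below \<open>2 / K\<close>, so a large \<open>K\<close> makes the digits thick.\<close>
lemma thick_digits_exists: "\<exists>\<alpha> \<beta>. thick_digits 200 \<alpha> \<beta>"
proof -
  define \<alpha> :: real where "\<alpha> = (sqrt (51 / 50) - 1) / 2"
  have "1 < sqrt (51 / 50)" by (rule real_less_rsqrt) simp
  moreover have "sqrt (51 / 50) < 101 / 100" by (rule real_less_lsqrt) (simp_all add: power2_eq_square)
  ultimately have \<alpha>: "0 < \<alpha>" "\<alpha> < 1 / 200" by (auto simp: \<alpha>_def)
  have "200 * ((s - 1) / 2) * (1 + (s - 1) / 2) = 50 * (s\<^sup>2 - 1)" for s :: real
    by (simp add: field_simps power2_eq_square)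
  from this[of "sqrt (51 / 50)"] have "200 * \<alpha> * (1 + \<alpha>) = 50 * ((sqrt (51 / 50))\<^sup>2 - 1)"
    by (simp only: \<alpha>_def)
  then have quad: "200 * \<alpha> * (1 + \<alpha>) = 1" by simp
  have \<beta>: "200 * \<alpha> = 1 / (1 + \<alpha>)" using quad \<alpha> by (simp add: field_simps)
  have "200 + 200 * \<alpha> = 200 * (1 + \<alpha>)" by simp
  then have "\<alpha> * (200 + 200 * \<alpha>) = 1" using quad by (simp add: algebra_simps)
  then have \<alpha>_eq: "\<alpha> = 1 / (200 + 200 * \<alpha>)" using \<alpha> by (simp add: field_simps)
  have "200 * \<alpha> * (1 + \<alpha>) \<le> 200 * \<alpha> * (201 / 200)" using \<alpha> by (intro mult_left_mono) auto
  then have "199 * \<alpha> \<ge> 72 / 73" using quad \<alpha> by auto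
  then have "thick_digits 200 \<alpha> (200 * \<alpha>)"
    using \<alpha> \<beta> \<alpha>_eq by unfold_locales (auto simp: algebra_simps)
  then show ?thesis by blast
qed

text \<open>For a palindrome \<open>W\<close> the form \<open>cform W 1 s 1 t\<close> is symmetric in \<open>s\<close> and \<open>t\<close>, of the kind covered by
  \<open>cf_values_cover\<close>; the inequality between its coefficients is \<open>cform_right_le\<close>.\<close>
lemma spiked_interval:
  assumes W: "W \<noteq> []" "0 \<notin> set W" "rev W = W"
  obtains v\<^sub>1 v\<^sub>2 where "(\<Prod>d\<leftarrow>W. real d) \<le> v\<^sub>1" "v\<^sub>1 < v\<^sub>2"
    "\<And>v. v \<in> {v\<^sub>1..v\<^sub>2} \<Longrightarrow> \<exists>b r. spiked W 200 b r v"
proof -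
  obtain \<alpha> \<beta> where "thick_digits 200 \<alpha> \<beta>" using thick_digits_exists by blast
  then interpret thick_digits 200 \<alpha> \<beta> .
  define A B C where "A = cform W 1 0 1 0" and "B = cform W 1 0 0 1" and "C = cform W 0 1 0 1"
  have sym: "cform W 0 1 1 0 = B" using cform_rev[of W 0 1 1 0] W(3) by (simp add: B_def)
  have form: "cform W 1 s 1 t = A + B * (s + t) + C * s * t" for s t
    using cform_left[of W 1 s 1 t] cform_right[of W 1 0 1 t] cform_right[of W 0 1 1 t] sym
    by (simp add: A_def B_def C_def algebra_simps)
  obtain d w where dw: "W = d # w" using W(1) by (cases W) auto
  have w: "0 \<notin> set w" using W(2) dw by auto
  have "C = cform w 1 0 0 1" "B = cform w 1 0 1 0"
    using sym by (simp_all add: C_def dw)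
  moreover have "1 \<le> cform w 1 0 1 0"
    using cform_ge_prod[of 1 0 0 w] prod_list_ge_1[OF w] by simp
  ultimately have BC: "0 \<le> C" "C \<le> B" "0 < B"
    using cform_right_le[OF w, of 0 1] cform_nonneg[of 1 0 0 1 w] by auto
  have A: "(\<Prod>d\<leftarrow>W. real d) \<le> A"
    using cform_ge_prod[of 1 0 0 W] by (simp add: A_def)
  show ?thesis
  proof (rule that)
    have "0 \<le> 2 * B * \<alpha> + C * \<alpha> * \<alpha>" using BC \<alpha>_pos by simp
    then show "(\<Prod>d\<leftarrow>W. real d) \<le> A + 2 * B * \<alpha> + C * \<alpha> * \<alpha>" using A by simp
    have "B * \<alpha> < B * \<beta>" using BC \<alpha>_less_\<beta> by simp
    moreover have "C * \<alpha> * \<alpha> \<le> C * \<beta> * \<beta>" using BC \<alpha>_less_\<beta> \<alpha>_pos by (intro mult_mono) auto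
    ultimately show "A + 2 * B * \<alpha> + C * \<alpha> * \<alpha> < A + 2 * B * \<beta> + C * \<beta> * \<beta>" by simp
    fix v assume "v \<in> {A + 2 * B * \<alpha> + C * \<alpha> * \<alpha>..A + 2 * B * \<beta> + C * \<beta> * \<beta>}"
    then obtain \<sigma> \<tau> where "\<And>i. \<sigma> i \<in> {1..200}" "\<And>i. \<tau> i \<in> {1..200}"
      "A + B * (cf_val \<sigma> + cf_val \<tau>) + C * cf_val \<sigma> * cf_val \<tau> = v"
      using cf_values_cover[OF BC(1,2), of A v] by auto
    then show "\<exists>b r. spiked W 200 b r v"
      using spiked_exists[of \<tau> 200 \<sigma> W] W(2) by (simp add: form)
  qed
qed

lemma cform_small_digit:
  assumes w: "0 \<notin> set w" "\<And>d. d \<in> set w \<Longrightarrow> d \<le> N" and d: "d \<in> set w" "d \<le> K"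
    and st: "s \<in> {0..1}" "t \<in> {0..1}" and len: "length w = Suc n"
  shows "cform w 1 s 1 t \<le> 2 * real (K + 1) * real (N + 1) ^ n"
proof -
  obtain u v where uv: "w = u @ d # v" using d(1) by (meson split_list)
  have "(\<Prod>d\<leftarrow>w. real d + 1) = (real d + 1) * ((\<Prod>d\<leftarrow>u. real d + 1) * (\<Prod>d\<leftarrow>v. real d + 1))"
    by (simp add: uv)
  also have "\<dots> \<le> real (K + 1) * (real (N + 1) ^ length u * real (N + 1) ^ length v)"
    using w(2) d(2) by (intro mult_mono prod_list_le_power mult_nonneg_nonneg prod_list_nonneg) (auto simp: uv)
  also have "\<dots> = real (K + 1) * real (N + 1) ^ n"
    using len by (simp add: uv flip: power_add)
  finally have "2 * (\<Prod>d\<leftarrow>w. real d + 1) \<le> 2 * (real (K + 1) * real (N + 1) ^ n)" by simp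
  moreover have "cform w 1 s 1 t \<le> 2 * (\<Prod>d\<leftarrow>w. real d + 1)"
    using cform_le_prod[of w s 1 t] w st by simp
  ultimately show ?thesis unfolding mult.assoc by (rule order_trans[rotated])
qed

text \<open>How large the spike digit \<open>N\<close> has to be: a word with one digit of at most \<open>K\<close> and \<open>n\<close> digits of at most
  \<open>N\<close> must lose against \<open>n + 1\<close> digits \<open>N\<close>, with a margin of \<open>2\<close> for the error terms of positive shifts.\<close>
lemma huge_digit:
  fixes K n :: nat
  assumes N: "N \<ge> (K + 3) * 2 ^ Suc n"
  shows "2 * real (K + 1) * real (N + 1) ^ n + 2 \<le> real N ^ Suc n" "K < N"
proof -
  have "(K + 3) * 1 \<le> (K + 3) * 2 ^ Suc n" by (intro mult_left_mono) auto
  from le_trans[OF this N] have "K + 3 \<le> N" by simp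
  then show KN: "K < N" by simp
  define P where "P = (2 * real N) ^ n"
  have P: "P \<ge> 1" unfolding P_def using KN by (intro one_le_power) auto
  have "real (N + 1) ^ n \<le> P" unfolding P_def using KN by (intro power_mono) auto
  then have "2 * real (K + 1) * real (N + 1) ^ n + 2 \<le> 2 * real (K + 1) * P + 2 * P"
    using P by (intro add_mono mult_left_mono) auto
  also have "\<dots> \<le> 2 * real (K + 3) * P" using P by (simp add: algebra_simps)
  also have "\<dots> = real ((K + 3) * 2 ^ Suc n) * real N ^ n"
    by (simp add: P_def power_mult_distrib)
  also have "\<dots> \<le> real N * real N ^ n" using N by (intro mult_right_mono) (simp_all only: of_nat_le_iff of_nat_0_le_iff zero_le_power)
  finally show "2 * real (K + 1) * real (N + 1) ^ n + 2 \<le> real N ^ Suc n" by simp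
qed

section \<open>Limits along the spikes\<close>

lemma liminf_of_spikes:
  fixes x y :: "nat \<Rightarrow> real"
  assumes r: "strict_mono r" and eq: "\<And>k. k \<ge> k\<^sub>0 \<Longrightarrow> x k = y k"
    and lim: "(\<lambda>j. y (r j)) \<longlonglongrightarrow> v"
    and ge: "\<And>k. k \<ge> k\<^sub>0 \<Longrightarrow> k \<notin> range r \<Longrightarrow> v \<le> y k"
  shows "liminf (\<lambda>k. ereal (x k)) = ereal v"
proof -
  have "liminf (\<lambda>k. ereal (x k)) = liminf (\<lambda>k. ereal (y k))"
    using eq by (intro Liminf_eq eventually_sequentiallyI[of k\<^sub>0]) simp
  also have "\<dots> = ereal v"
  proof (rule antisym)
    have "liminf (\<lambda>k. ereal (y k)) \<le> liminf ((\<lambda>k. ereal (y k)) \<circ> r)"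
      by (rule liminf_subseq_mono[OF r])
    also have "\<dots> = ereal v"
      using lim by (intro lim_imp_Liminf) (auto simp: o_def)
    finally show "liminf (\<lambda>k. ereal (y k)) \<le> ereal v" .
    show "ereal v \<le> liminf (\<lambda>k. ereal (y k))"
      unfolding le_Liminf_iff
    proof (intro allI impI)
      fix z assume z: "z < ereal v"
      have "\<forall>\<^sub>F j in sequentially. z < ereal (y (r j))"
        using lim z by (intro order_tendstoD[where a = z]) auto
      then obtain J where J: "\<And>j. j \<ge> J \<Longrightarrow> z < ereal (y (r j))"
        by (auto simp: eventually_sequentially)
      show "\<forall>\<^sub>F k in sequentially. z < ereal (y k)"
        using eventually_ge_at_top[of "max k\<^sub>0 (r J)"]
      proof eventually_elim
        case (elim k)
        show ?case
        proof (cases "k \<in> range r")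
          case True
          then show ?thesis using J elim r by (auto simp: strict_mono_less_eq)
        next
          case False
          then have "ereal v \<le> ereal (y k)" using ge elim by simp
          with z show ?thesis by (rule less_le_trans)
        qed
      qed
    qed
  qed
  finally show ?thesis .
qed

lemma limsup_of_spikes:
  fixes x y :: "nat \<Rightarrow> real"
  assumes r: "strict_mono r" and eq: "\<And>k. k \<ge> k\<^sub>0 \<Longrightarrow> x k = y k"
    and lim: "(\<lambda>j. y (r j)) \<longlonglongrightarrow> v"
    and le: "\<And>k. k \<ge> k\<^sub>0 \<Longrightarrow> k \<notin> range r \<Longrightarrow> y k \<le> v"
  shows "limsup (\<lambda>k. ereal (x k)) = ereal v"
proof -
  have "liminf (\<lambda>k. ereal (- x k)) = ereal (- v)"
    by (rule liminf_of_spikes[OF r, where k\<^sub>0 = k\<^sub>0 and y = "\<lambda>k. - y k"])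
      (use eq le tendsto_minus[OF lim] in auto)
  then have "- limsup (\<lambda>k. ereal (x k)) = - ereal v"
    by (simp flip: ereal_Liminf_uminus)
  then show ?thesis by (simp only: ereal_uminus_eq_iff)
qed

text \<open>The limits are found in the form \<open>c + e / v\<close> with \<open>v\<close> in an interval.\<close>
lemma interval_from_reciprocals:
  assumes v: "0 < v\<^sub>1" "v\<^sub>1 < v\<^sub>2" and e: "e = 1 \<or> e = -1"
    and S: "\<And>v. v \<in> {v\<^sub>1..v\<^sub>2} \<Longrightarrow> ereal (c + e / v) \<in> S"
  shows "contains_nondegenerate_interval S"
proof -
  have inv: "1 / v\<^sub>2 < 1 / v\<^sub>1" using v by (simp add: frac_less2)
  have mem: "1 / y \<in> {v\<^sub>1..v\<^sub>2}" if "y \<in> {1 / v\<^sub>2..1 / v\<^sub>1}" for y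
  proof -
    have "0 < 1 / v\<^sub>2" using v by simp
    then have "0 < y" using that by (meson atLeastAtMost_iff less_le_trans)
    then show ?thesis using that v by (auto simp: field_simps)
  qed
  have img: "ereal y \<in> S" if "e * (y - c) \<in> {1 / v\<^sub>2..1 / v\<^sub>1}" for y
    using S[OF mem[OF that]] e by auto
  have "ereal ` {c + 1 / v\<^sub>2..c + 1 / v\<^sub>1} \<subseteq> S" if "e = 1"
    using img that by auto
  moreover have "ereal ` {c - 1 / v\<^sub>1..c - 1 / v\<^sub>2} \<subseteq> S" if "e = -1"
    using img that by (auto simp: algebra_simps)
  moreover have "c + 1 / v\<^sub>2 < c + 1 / v\<^sub>1" "c - 1 / v\<^sub>1 < c - 1 / v\<^sub>2" using inv by auto
  ultimately show ?thesis
    unfolding contains_nondegenerate_interval_def using e by blast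
qed

lemma (in digit_seq) cf_val_admissible: "cf_val b \<in> {0..1} - \<rat>"
  using cf_val_range[of b, OF b_ge_1] cf_val_irrational[of b, OF b_ge_1] by simp

lemma spiked_digit_le:
  assumes "spiked W K b r v" "\<And>d. d \<in> set W \<Longrightarrow> d \<le> N" "K \<le> N"
  shows "b i \<le> N"
proof (cases "K < b i")
  case True
  then obtain j d where "i = r j + d" "d < length W" using assms(1) by (auto simp: spiked_def)
  then show ?thesis using assms(1,2) by (auto simp: spiked_def)
next
  case False
  then show ?thesis using assms(3) by simp
qed

text \<open>If all digits of a window away from the spikes were above \<open>K\<close>, then the window would begin strictly
  inside a spike and so contain the small digit that follows the spike.\<close>
lemma spiked_window_le:
  assumes s: "spiked (replicate (Suc n) N) K b r v" and N: "N \<ge> (K + 3) * 2 ^ Suc n"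
    and k: "k \<notin> range r"
  shows "digit_seq.window b k (Suc n) \<le> real N ^ Suc n"
proof -
  interpret digit_seq b using s by (simp add: spiked_def)
  have "\<exists>d\<in>set (map b [k..<k + Suc n]). d \<le> K"
  proof (rule ccontr)
    assume "\<not> ?thesis"
    then have big: "K < b i" if "k \<le> i" "i \<le> k + n" for i
      using that by (auto simp: not_le)
    obtain j d where jd: "k = r j + d" "d < Suc n"
      using s big[of k] by (auto simp: spiked_def)
    moreover have "d \<noteq> 0" using jd k by auto
    ultimately have "K < b (r j + Suc n)" using big[of "r j + Suc n"] by simp
    moreover have "b (r j + Suc n) \<le> K" using s by (simp add: spiked_def)
    ultimately show False by simp
  qed
  then obtain d where d: "d \<in> set (map b [k..<k + Suc n])" "d \<le> K" by blast
  have "window k (Suc n) \<le> 2 * real (K + 1) * real (N + 1) ^ n"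
    unfolding window_def
  proof (rule cform_small_digit[OF zero_notin_digits _ d ratio_range])
    show "e \<le> N" if "e \<in> set (map b [k..<k + Suc n])" for e
      using that spiked_digit_le[OF s, of N] huge_digit(2)[OF N] by (auto split: if_splits)
    show "tail (k + Suc n) \<in> {0..1}" using tail_pos tail_less_1 by (simp add: less_imp_le)
  qed simp
  also have "\<dots> \<le> real N ^ Suc n" using huge_digit(1)[OF N] by simp
  finally show ?thesis .
qed

text \<open>Here the spikes are runs of \<open>n + 1\<close> huge digits, so that only the windows at the runs are free of
  small digits.\<close>
lemma run_values:
  obtains v\<^sub>1 v\<^sub>2 where "0 < v\<^sub>1" "v\<^sub>1 < v\<^sub>2"
    "\<And>v. v \<in> {v\<^sub>1..v\<^sub>2} \<Longrightarrow> \<exists>b r. digit_seq b \<and> strict_mono r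
       \<and> (\<lambda>j. 1 / digit_seq.window b (r j) (Suc n)) \<longlonglongrightarrow> 1 / v
       \<and> (\<forall>k. k \<notin> range r \<longrightarrow> 1 / v \<le> 1 / digit_seq.window b k (Suc n))"
proof -
  define N :: nat where "N = (200 + 3) * 2 ^ Suc n"
  have N: "N \<ge> (200 + 3) * 2 ^ Suc n" and N0: "0 < N" by (simp_all add: N_def)
  define W where "W = replicate (Suc n) N"
  have W: "W \<noteq> []" "0 \<notin> set W" "rev W = W" using N0 unfolding W_def by (auto simp del: replicate_Suc)
  from spiked_interval[OF W] obtain v\<^sub>1 v\<^sub>2 where v: "(\<Prod>d\<leftarrow>W. real d) \<le> v\<^sub>1" "v\<^sub>1 < v\<^sub>2"
    "\<And>v. v \<in> {v\<^sub>1..v\<^sub>2} \<Longrightarrow> \<exists>b r. spiked W 200 b r v" by blast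
  have prodW: "(\<Prod>d\<leftarrow>W. real d) = real N ^ Suc n" by (simp add: W_def)
  then have v1: "0 < v\<^sub>1" using v(1) N0 by (metis less_le_trans of_nat_0_less_iff zero_less_power)
  show ?thesis
  proof (rule that[OF v1 v(2)])
    fix v assume vin: "v \<in> {v\<^sub>1..v\<^sub>2}"
    obtain b r where s: "spiked W 200 b r v" using v(3)[OF vin] by blast
    interpret digit_seq b using s by (simp add: spiked_def)
    have r: "strict_mono r" and lim: "(\<lambda>j. window (r j) (Suc n)) \<longlonglongrightarrow> v"
      using s by (auto simp: spiked_def W_def)
    have "(\<lambda>j. 1 / window (r j) (Suc n)) \<longlonglongrightarrow> 1 / v"
      using v1 vin by (intro tendsto_intros lim) auto
    moreover have "1 / v \<le> 1 / window k (Suc n)" if "k \<notin> range r" for k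
    proof -
      have "window k (Suc n) \<le> real N ^ Suc n"
        by (rule spiked_window_le[OF s[unfolded W_def] N that])
      then have "window k (Suc n) \<le> v" using v(1) vin prodW by simp
      then show ?thesis
        using window_ge_1[of k "Suc n"] v1 vin by (intro divide_left_mono mult_pos_pos) auto
    qed
    ultimately show "\<exists>b r. digit_seq b \<and> strict_mono r
       \<and> (\<lambda>j. 1 / digit_seq.window b (r j) (Suc n)) \<longlonglongrightarrow> 1 / v
       \<and> (\<forall>k. k \<notin> range r \<longrightarrow> 1 / v \<le> 1 / digit_seq.window b k (Suc n))"
      using digit_seq_axioms r by blast
  qed
qed

lemma I_set_interval: "contains_nondegenerate_interval (I_set (- int n))"
proof -
  obtain v\<^sub>1 v\<^sub>2 where v: "0 < v\<^sub>1" "v\<^sub>1 < v\<^sub>2"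
    "\<And>v. v \<in> {v\<^sub>1..v\<^sub>2} \<Longrightarrow> \<exists>b r. digit_seq b \<and> strict_mono r
       \<and> (\<lambda>j. 1 / digit_seq.window b (r j) (Suc n)) \<longlonglongrightarrow> 1 / v
       \<and> (\<forall>k. k \<notin> range r \<longrightarrow> 1 / v \<le> 1 / digit_seq.window b k (Suc n))"
    using run_values[of n] by blast
  have "ereal (0 + 1 / v) \<in> I_set (- int n)" if vin: "v \<in> {v\<^sub>1..v\<^sub>2}" for v
  proof -
    obtain b r where b: "digit_seq b" and r: "strict_mono r"
      and lim: "(\<lambda>j. 1 / digit_seq.window b (r j) (Suc n)) \<longlonglongrightarrow> 1 / v"
      and ge: "\<And>k. k \<notin> range r \<Longrightarrow> 1 / v \<le> 1 / digit_seq.window b k (Suc n)"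
      using v(3)[OF vin] by blast
    interpret digit_seq b by (rule b)
    have "liminf (\<lambda>k. ereal (approx_seq (- int n) (cf_val b) k)) = ereal (1 / v)"
    proof (rule liminf_of_spikes[where r = "\<lambda>j. r j + n" and k\<^sub>0 = "Suc n"
          and y = "\<lambda>k. 1 / window (k - n) (Suc n)"])
      show "strict_mono (\<lambda>j. r j + n)" using r by (simp add: strict_mono_def)
      show "approx_seq (- int n) (cf_val b) k = 1 / window (k - n) (Suc n)" if "Suc n \<le> k" for k
        using approx_seq_nonpos[of "k - n" n] that by simp
      show "(\<lambda>j. 1 / window (r j + n - n) (Suc n)) \<longlonglongrightarrow> 1 / v" using lim by simp
      show "1 / v \<le> 1 / window (k - n) (Suc n)" if "Suc n \<le> k" "k \<notin> range (\<lambda>j. r j + n)" for k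
      proof (rule ge, rule notI)
        assume "k - n \<in> range r"
        then obtain j where "k - n = r j" by auto
        then have "k = r j + n" using that by simp
        then show False using that by auto
      qed
    qed
    then show ?thesis
      unfolding I_set_def using cf_val_admissible by (auto intro!: exI[of _ "cf_val b"])
  qed
  then show ?thesis using v(1,2) by (intro interval_from_reciprocals[of v\<^sub>1 v\<^sub>2 1 0]) auto
qed

text \<open>For \<open>m = 1\<close> the continuant in \<open>approx_seq_pos\<close> is empty and equal to \<open>1\<close>, so the upper limit is \<open>1\<close> minus a
  lower limit as for \<open>m = -1\<close>.\<close>
lemma S_set_1_interval: "contains_nondegenerate_interval (S_set 1)"
proof -
  obtain v\<^sub>1 v\<^sub>2 where v: "0 < v\<^sub>1" "v\<^sub>1 < v\<^sub>2"
    "\<And>v. v \<in> {v\<^sub>1..v\<^sub>2} \<Longrightarrow> \<exists>b r. digit_seq b \<and> strict_mono r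
       \<and> (\<lambda>j. 1 / digit_seq.window b (r j) (Suc 1)) \<longlonglongrightarrow> 1 / v
       \<and> (\<forall>k. k \<notin> range r \<longrightarrow> 1 / v \<le> 1 / digit_seq.window b k (Suc 1))"
    using run_values[of 1] by blast
  have "ereal (1 + - 1 / v) \<in> S_set 1" if vin: "v \<in> {v\<^sub>1..v\<^sub>2}" for v
  proof -
    obtain b r where b: "digit_seq b" and r: "strict_mono r"
      and lim: "(\<lambda>j. 1 / digit_seq.window b (r j) (Suc 1)) \<longlonglongrightarrow> 1 / v"
      and ge: "\<And>k. k \<notin> range r \<Longrightarrow> 1 / v \<le> 1 / digit_seq.window b k (Suc 1)"
      using v(3)[OF vin] by blast
    interpret digit_seq b by (rule b)
    have "limsup (\<lambda>k. ereal (approx_seq 1 (cf_val b) k)) = ereal (1 - 1 / v)"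
    proof (rule limsup_of_spikes[OF r, where k\<^sub>0 = 1 and y = "\<lambda>k. 1 - 1 / window k (Suc 1)"])
      show "approx_seq 1 (cf_val b) k = 1 - 1 / window k (Suc 1)" if "1 \<le> k" for k
        using approx_seq_pos[OF that, of 0] by simp
      show "(\<lambda>j. 1 - 1 / window (r j) (Suc 1)) \<longlonglongrightarrow> 1 - 1 / v"
        by (intro tendsto_diff tendsto_const lim)
      show "1 - 1 / window k (Suc 1) \<le> 1 - 1 / v" if "k \<notin> range r" for k
        using ge[OF that] by simp
    qed
    then show ?thesis
      unfolding S_set_def using cf_val_admissible by (auto intro!: exI[of _ "cf_val b"])
  qed
  then show ?thesis using v(1,2) by (intro interval_from_reciprocals[of v\<^sub>1 v\<^sub>2 "-1" 1]) auto
qed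

text \<open>For \<open>m = n + 2\<close> the continuant of \<open>n + 1\<close> digits dominates, so it must be maximal at the spikes; a run of
  \<open>n + 1\<close> huge digits does this, and makes it the same constant \<open>A\<close> at all spikes.  The freedom lies in
  the small term \<open>e / v\<close>.  The spike word has a digit \<open>1\<close> at each end because the window of that term is
  longer than the continuant by one digit on either side.\<close>
lemma S_set_interval: "contains_nondegenerate_interval (S_set (int (Suc (Suc n))))"
proof -
  define N :: nat where "N = (200 + 3) * 2 ^ Suc n"
  have N: "N \<ge> (200 + 3) * 2 ^ Suc n" and N0: "0 < N" by (simp_all add: N_def)
  define R where "R = replicate (Suc n) N"
  define W where "W = 1 # R @ [1]"
  have W: "W \<noteq> []" "0 \<notin> set W" "rev W = W" using N0 unfolding W_def R_def by (auto simp del: replicate_Suc)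
  have len: "length W = Suc (Suc (Suc n))" by (simp add: W_def R_def)
  from spiked_interval[OF W] obtain v\<^sub>1 v\<^sub>2 where v: "(\<Prod>d\<leftarrow>W. real d) \<le> v\<^sub>1" "v\<^sub>1 < v\<^sub>2"
    "\<And>v. v \<in> {v\<^sub>1..v\<^sub>2} \<Longrightarrow> \<exists>b r. spiked W 200 b r v" by blast
  have v1: "1 \<le> v\<^sub>1" using prod_list_ge_1[OF W(2)] v(1) by linarith
  define A where "A = cform R 1 0 1 0"
  define e :: real where "e = (- 1) ^ n"
  have e: "e = 1 \<or> e = - 1" unfolding e_def by (cases "even n") auto
  have A: "real N ^ Suc n \<le> A"
    using cform_ge_prod[of 1 0 0 R] by (simp add: A_def R_def)
  have "ereal (A + e / v) \<in> S_set (int (Suc (Suc n)))" if vin: "v \<in> {v\<^sub>1..v\<^sub>2}" for v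
  proof -
    obtain b r where s: "spiked W 200 b r v" using v(3)[OF vin] by blast
    interpret digit_seq b using s by (simp add: spiked_def)
    have r: "strict_mono r" and lim: "(\<lambda>j. window (r j) (Suc (Suc (Suc n)))) \<longlonglongrightarrow> v"
      and word: "\<And>j d. d < Suc (Suc (Suc n)) \<Longrightarrow> b (r j + d) = W ! d"
      and spike: "\<And>i. 200 < b i \<Longrightarrow> \<exists>j d. i = r j + d \<and> d < Suc (Suc (Suc n))"
      using s by (auto simp: spiked_def len)
    let ?x = "approx_seq (int (Suc (Suc n))) (cf_val b)"
    let ?A = "\<lambda>k. cform (map b [Suc k..<Suc k + Suc n]) 1 0 1 0"
    let ?y = "\<lambda>k. ?A k + e / window k (Suc (Suc (Suc n)))"
    have "limsup (\<lambda>k. ereal (?x k)) = ereal (A + e / v)"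
    proof (rule limsup_of_spikes[OF r, where k\<^sub>0 = 1 and y = ?y])
      show "?x k = ?y k" if "1 \<le> k" for k
        using approx_seq_pos[OF that, of "Suc n"] by (simp add: e_def)
      have "map b [Suc (r j)..<Suc (r j) + Suc n] = R" for j
      proof (rule nth_equalityI)
        fix i assume "i < length (map b [Suc (r j)..<Suc (r j) + Suc n])"
        then have i: "i < Suc n" by (simp del: upt_Suc)
        then show "map b [Suc (r j)..<Suc (r j) + Suc n] ! i = R ! i"
          using word[of "Suc i" j] by (simp add: W_def R_def nth_append del: upt_Suc replicate_Suc)
      qed (simp add: R_def del: upt_Suc)
      then have "?y (r j) = A + e / window (r j) (Suc (Suc (Suc n)))" for j by (simp only: A_def)
      moreover have "(\<lambda>j. A + e / window (r j) (Suc (Suc (Suc n)))) \<longlonglongrightarrow> A + e / v"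
        using v1 vin by (intro tendsto_intros lim) auto
      ultimately show "(\<lambda>j. ?y (r j)) \<longlonglongrightarrow> A + e / v" by (simp only:)
    next
      fix k assume k: "1 \<le> k" "k \<notin> range r"
      let ?w = "map b [Suc k..<Suc k + Suc n]"
      have "\<exists>d\<in>set ?w. d \<le> 200"
      proof (rule ccontr)
        assume "\<not> ?thesis"
        then have big: "200 < b i" if "Suc k \<le> i" "i \<le> Suc k + n" for i
          using that by (auto simp: not_le simp del: upt_Suc)
        obtain j d where jd: "Suc k = r j + d" "d < Suc (Suc (Suc n))"
          using spike[OF big[of "Suc k"]] by auto
        \<comment> \<open>Position \<open>k + 1\<close> is in the run of huge digits but not its start, so the final digit \<open>1\<close> of the
          spike is among the digits considered.\<close>
        have d1: "d \<noteq> 1" using jd k by auto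
        have "W ! d > 200" using big[of "Suc k"] word[OF jd(2), of j] jd(1) by simp
        then have "d \<noteq> 0" by (intro notI) (simp add: W_def)
        then have "200 < b (r j + Suc (Suc n))" using d1 jd by (intro big) auto
        then show False using word[of "Suc (Suc n)" j] by (simp add: W_def R_def nth_append)
      qed
      then obtain d where d: "d \<in> set ?w" "d \<le> 200" by blast
      have "?A k \<le> 2 * real (200 + 1) * real (N + 1) ^ n"
      proof (rule cform_small_digit[OF zero_notin_digits _ d])
        have "c \<le> N" if "c \<in> set W" for c using that N0 by (auto simp: W_def R_def)
        then show "c \<le> N" if "c \<in> set ?w" for c
          using that spiked_digit_le[OF s, of N] huge_digit(2)[OF N] by (auto split: if_splits)
      qed simp_all
      also have "\<dots> \<le> A - 2" using huge_digit(1)[OF N] A by simp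
      finally have "?A k \<le> A - 2" .
      moreover have "e / u \<le> 1" "- 1 \<le> e / u" if "u \<ge> 1" for u
        using that e by (auto simp: divide_simps)
      from this(1)[OF window_ge_1[of k "Suc (Suc (Suc n))"]] this(2)[of v]
      have "e / window k (Suc (Suc (Suc n))) \<le> 1" "- 1 \<le> e / v" using vin v1 by auto
      ultimately show "?y k \<le> A + e / v" by linarith
    qed
    then show ?thesis
      unfolding S_set_def using cf_val_admissible by (auto intro!: exI[of _ "cf_val b"])
  qed
  then show ?thesis using v1 v(2) e by (intro interval_from_reciprocals[of v\<^sub>1 v\<^sub>2 e A]) auto
qed

theorem theorem52:
  shows "(\<forall>m::int. m \<le> 0 \<longrightarrow> contains_nondegenerate_interval (I_set m)) \<and>
         (\<forall>m::int. m \<ge> 1 \<longrightarrow> contains_nondegenerate_interval (S_set m))"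
proof (intro conjI allI impI)
  fix m :: int assume "m \<le> 0"
  then have "m = - int (nat (- m))" by simp
  then show "contains_nondegenerate_interval (I_set m)" using I_set_interval by metis
next
  fix m :: int assume m: "m \<ge> 1"
  show "contains_nondegenerate_interval (S_set m)"
  proof (cases "m = 1")
    case True
    then show ?thesis using S_set_1_interval by simp
  next
    case False
    then have "m = int (Suc (Suc (nat (m - 2))))" using m by simp
    then show ?thesis using S_set_interval by metis
  qed
qed

end
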